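(* Let $R$ be a ring and $L$ a nonzero left $R$-module. For each $n\ge 0$ define an operator $\mathrm{cl}_{R^n}$ on subsets of $R^n$ by $$\mathrm{cl}_{R^n}(S)=\Big\{x\in R^n \;\Big|\; xL\subseteq \sum_{s\in S} sL\Big\}\qquad (S\subseteq R^n).$$ Then this family of operators satisfies the following three conditions: (1) for every $n\ge 0$, $\mathrm{cl}_{R^n}$ is a closure operator on the underlying set of the right $R$-module $R^n$, and its closed subsets are right $R$-submodules; (2) for all $n>0$, $\mathrm{cl}_{R^n}(\emptyset)$ is a proper submodule of $R^n$; (3) for all $m,n\ge 0$, every homomorphism of right $R$-modules $h:R^m\to R^n$ and every $\mathrm{cl}_{R^n}$-closed submodule $A\subseteq R^n$, the submodule $h^{-1}(A)\subseteq R^m$ is $\mathrm{cl}_{R^m}$-closed. Moreover, for each $n\ge 0$, the condition that $\mathrm{cl}_{R^n}$ have the exchange property (4) for all $S\subseteq R^n$ and $t,u\in R^n$, if $u\notin \mathrm{cl}_{R^n}(S)$ but $u\in \mathrm{cl}_{R^n}(S\cup\{t\})$, then $t\in \mathrm{cl}_{R^n}(S\cup\{u\})$ is equivalent to each of the following three statements: (a) there do not exist a subset $S\subseteq R^n$ and elements $u,t\in R^n$ such that $\sum_{s\in S}sL\subsetneqq \sum_{s\in S\cup\{u\}}sL\subsetneqq \sum_{s\in S\cup\{t\}}sL$; (b) there do not exist an $n\times (n-1)$ matrix $A$ over $R$ and $n\times n$ matrices $B$ and $C$ over $R$, each obtained by adding a single column to $A$, such that $A\,L^{n-1}\subsetneqq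 B\,L^n\subsetneqq C\,L^n$; (c) there do not exist $n\times n$ matrices $A,B,C$ over $R$ which all agree except in one column, such that $A\,L^n\subsetneqq B\,L^n\subsetneqq C\,L^n$. Hence, if a ring $R$ has a faithful (nonzero) left module $L$ which for all $n\ge 0$ satisfies (a), equivalently (b), equivalently (c), then $R$ is embeddable in a division ring.
   Context: Rings are associative with $1$, not necessarily commutative; ring homomorphisms preserve $1$; modules are unital. "Embeddable in a division ring" means there is an injective ring homomorphism into a division ring. A closure operator on a set $X$ is a map $\mathrm{cl}$ from subsets of $X$ to subsets of $X$ such that for all $S,T\subseteq X$: $S\subseteq T\Rightarrow \mathrm{cl}(S)\subseteq \mathrm{cl}(T)$; $\mathrm{cl}(S)\supseteq S$; $\mathrm{cl}(\mathrm{cl}(S))=\mathrm{cl}(S)$. A subset is closed if it equals its closure. Elements of $R^n$ and of $L^n$ are written as column vectors. For $x\in R^n$ and $\ell\in L$, $x\ell=(x_1\ell,\dots,x_n\ell)\in L^n$, and $xL=\{x\ell\mid \ell\in L\}$, an additive subgroup of $L^n$; sums $\sum_{s\in S}sL$ are sums of additive subgroups of $L^n$ (the empty sum being $\{0\}$). An $n\times m$ matrix $A$ over $R$ maps $L^m$ to $L^n$ by left multiplication, and $A\,L^m$ denotes the image. For $n=1$, an $n\times(n-1)$ matrix is the empty $1\times 0$ matrix, with image $\{0\}$. For $n=0$ condition (b) is understood to hold vacuously. *)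

theory Defs
  imports "Jordan_Normal_Form.Matrix"
begin

text \<open>
  The ring is a type of class \<open>ring_1\<close>. This class excludes the zero ring, but over the zero
  ring there is no nonzero unital module. \<open>R\<^sup>n\<close> and \<open>L\<^sup>n\<close> are \<open>carrier_vec n\<close>; note that
  \<open>\<cdot>\<^sub>v\<close> multiplies from the left, so it is not the right module structure of \<open>R\<^sup>n\<close>.
\<close>

locale left_module =
  fixes scale :: "'r::ring_1 \<Rightarrow> 'l::ab_group_add \<Rightarrow> 'l"
  assumes scale_add_right: "scale r (x + y) = scale r x + scale r y"
    and scale_add_left: "scale (r + s) x = scale r x + scale s x"
    and scale_scale: "scale r (scale s x) = scale (r * s) x"
    and scale_one: "scale 1 x = x"

definition faithful :: "('r::ring_1 \<Rightarrow> 'l::ab_group_add \<Rightarrow> 'l) \<Rightarrow> bool" where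
  "faithful scale \<longleftrightarrow> (\<forall>r. (\<forall>l. scale r l = 0) \<longrightarrow> r = 0)"

subsection \<open>The right module of column vectors\<close>

definition rsmult :: "'r::ring_1 vec \<Rightarrow> 'r \<Rightarrow> 'r vec" where
  "rsmult x r = map_vec (\<lambda>a. a * r) x"

definition right_submodule :: "nat \<Rightarrow> 'r::ring_1 vec set \<Rightarrow> bool" where
  "right_submodule n A \<longleftrightarrow> A \<subseteq> carrier_vec n \<and> 0\<^sub>v n \<in> A \<and>
     (\<forall>x\<in>A. \<forall>y\<in>A. x + y \<in> A) \<and> (\<forall>x\<in>A. - x \<in> A) \<and> (\<forall>x\<in>A. \<forall>r. rsmult x r \<in> A)"

definition right_module_hom :: "nat \<Rightarrow> nat \<Rightarrow> ('r::ring_1 vec \<Rightarrow> 'r vec) \<Rightarrow> bool" where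
  "right_module_hom m n h \<longleftrightarrow> h \<in> carrier_vec m \<rightarrow> carrier_vec n \<and>
     (\<forall>x\<in>carrier_vec m. \<forall>y\<in>carrier_vec m. h (x + y) = h x + h y) \<and>
     (\<forall>x\<in>carrier_vec m. \<forall>r. h (rsmult x r) = rsmult (h x) r)"

subsection \<open>Closure operators\<close>

definition closure_operator :: "'a set \<Rightarrow> ('a set \<Rightarrow> 'a set) \<Rightarrow> bool" where
  "closure_operator X cl \<longleftrightarrow>
     (\<forall>S. S \<subseteq> X \<longrightarrow> cl S \<subseteq> X) \<and>
     (\<forall>S T. S \<subseteq> X \<longrightarrow> T \<subseteq> X \<longrightarrow> S \<subseteq> T \<longrightarrow> cl S \<subseteq> cl T) \<and>
     (\<forall>S. S \<subseteq> X \<longrightarrow> S \<subseteq> cl S) \<and>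
     (\<forall>S. S \<subseteq> X \<longrightarrow> cl (cl S) = cl S)"

definition closed_subset :: "'a set \<Rightarrow> ('a set \<Rightarrow> 'a set) \<Rightarrow> 'a set \<Rightarrow> bool" where
  "closed_subset X cl A \<longleftrightarrow> A \<subseteq> X \<and> cl A = A"

definition exchange_property :: "'a set \<Rightarrow> ('a set \<Rightarrow> 'a set) \<Rightarrow> bool" where
  "exchange_property X cl \<longleftrightarrow>
     (\<forall>S t u. S \<subseteq> X \<longrightarrow> t \<in> X \<longrightarrow> u \<in> X \<longrightarrow>
        u \<notin> cl S \<longrightarrow> u \<in> cl (S \<union> {t}) \<longrightarrow> t \<in> cl (S \<union> {u}))"

subsection \<open>The closure operators induced by a left module\<close>

definition vec_times_module ::
  "('r::ring_1 \<Rightarrow> 'l::ab_group_add \<Rightarrow> 'l) \<Rightarrow> 'r vec \<Rightarrow> 'l vec set" where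
  "vec_times_module scale x = {map_vec (\<lambda>a. scale a l) x | l. True}"

text \<open>The sum \<open>\<Sum>s\<in>S. sL\<close> of subgroups of \<open>L\<^sup>n\<close>, for \<open>S\<close> possibly infinite: all finite sums of
  elements of the summands.\<close>

definition sum_times_module ::
  "('r::ring_1 \<Rightarrow> 'l::ab_group_add \<Rightarrow> 'l) \<Rightarrow> nat \<Rightarrow> 'r vec set \<Rightarrow> 'l vec set" where
  "sum_times_module scale n S =
     {finsum_vec TYPE('l) n f F | f F.
        finite F \<and> F \<subseteq> S \<and> (\<forall>s\<in>F. f s \<in> vec_times_module scale s)}"

definition module_cl ::
  "('r::ring_1 \<Rightarrow> 'l::ab_group_add \<Rightarrow> 'l) \<Rightarrow> nat \<Rightarrow> 'r vec set \<Rightarrow> 'r vec set" where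
  "module_cl scale n S =
     {x \<in> carrier_vec n. vec_times_module scale x \<subseteq> sum_times_module scale n S}"

definition mat_times_vec ::
  "('r::ring_1 \<Rightarrow> 'l::ab_group_add \<Rightarrow> 'l) \<Rightarrow> 'r mat \<Rightarrow> 'l vec \<Rightarrow> 'l vec" where
  "mat_times_vec scale A v =
     vec (dim_row A) (\<lambda>i. \<Sum>j<dim_col A. scale (A $$ (i, j)) (v $ j))"

definition mat_image ::
  "('r::ring_1 \<Rightarrow> 'l::ab_group_add \<Rightarrow> 'l) \<Rightarrow> 'r mat \<Rightarrow> 'l vec set" where
  "mat_image scale A = mat_times_vec scale A ` carrier_vec (dim_col A)"

subsection \<open>The chain conditions\<close>

definition no_vector_chain ::
  "('r::ring_1 \<Rightarrow> 'l::ab_group_add \<Rightarrow> 'l) \<Rightarrow> nat \<Rightarrow> bool" where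
  "no_vector_chain scale n \<longleftrightarrow>
     \<not> (\<exists>S u t. S \<subseteq> carrier_vec n \<and> u \<in> carrier_vec n \<and> t \<in> carrier_vec n \<and>
          sum_times_module scale n S \<subset> sum_times_module scale n (S \<union> {u}) \<and>
          sum_times_module scale n (S \<union> {u}) \<subset> sum_times_module scale n (S \<union> {t}))"

text \<open>The added column may be inserted at any position.\<close>

definition adds_column :: "'r mat \<Rightarrow> 'r mat \<Rightarrow> bool" where
  "adds_column A B \<longleftrightarrow> dim_row B = dim_row A \<and>
     (\<exists>j v. j \<le> dim_col A \<and> cols B = take j (cols A) @ v # drop j (cols A))"

definition no_added_column_chain ::
  "('r::ring_1 \<Rightarrow> 'l::ab_group_add \<Rightarrow> 'l) \<Rightarrow> nat \<Rightarrow> bool" where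
  "no_added_column_chain scale n \<longleftrightarrow> (n > 0 \<longrightarrow>
     \<not> (\<exists>A B C. A \<in> carrier_mat n (n - 1) \<and> B \<in> carrier_mat n n \<and> C \<in> carrier_mat n n \<and>
          adds_column A B \<and> adds_column A C \<and>
          mat_image scale A \<subset> mat_image scale B \<and> mat_image scale B \<subset> mat_image scale C))"

definition no_changed_column_chain ::
  "('r::ring_1 \<Rightarrow> 'l::ab_group_add \<Rightarrow> 'l) \<Rightarrow> nat \<Rightarrow> bool" where
  "no_changed_column_chain scale n \<longleftrightarrow>
     \<not> (\<exists>A B C. A \<in> carrier_mat n n \<and> B \<in> carrier_mat n n \<and> C \<in> carrier_mat n n \<and>
          (\<exists>j<n. \<forall>k<n. k \<noteq> j \<longrightarrow> col A k = col B k \<and> col B k = col C k) \<and>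
          mat_image scale A \<subset> mat_image scale B \<and> mat_image scale B \<subset> mat_image scale C)"

subsection \<open>Embeddability in a division ring\<close>

definition is_division_ring :: "('a, 'b) ring_scheme \<Rightarrow> bool" where
  "is_division_ring D \<longleftrightarrow> ring D \<and> \<one>\<^bsub>D\<^esub> \<noteq> \<zero>\<^bsub>D\<^esub> \<and> Units D = carrier D - {\<zero>\<^bsub>D\<^esub>}"

text \<open>
  A type cannot be quantified existentially, so the elements of the division ring are taken from
  the fixed type \<open>'r mat set\<close>. This is no restriction: inside any division ring containing the
  ring, the division subring generated by it has at most \<open>max |R| \<aleph>\<^sub>0\<close> elements,
  hence can be copied onto a subset of that type.
\<close>

definition embeddable_in_division_ring :: "'r::ring_1 itself \<Rightarrow> bool" where
  "embeddable_in_division_ring _ \<longleftrightarrow>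
     (\<exists>(D :: 'r mat set ring) (h :: 'r \<Rightarrow> 'r mat set).
        is_division_ring D \<and> range h \<subseteq> carrier D \<and> inj h \<and> h 1 = \<one>\<^bsub>D\<^esub> \<and>
        (\<forall>a b. h (a + b) = h a \<oplus>\<^bsub>D\<^esub> h b) \<and> (\<forall>a b. h (a * b) = h a \<otimes>\<^bsub>D\<^esub> h b))"

end

theory Submission
  imports Defs
begin

text \<open>
  The matrix conditions (b) and (c) give exchange for sets of fewer than \<open>n\<close> vectors. This suffices
  for Steinitz's argument against the unit vectors of \<open>R\<^sup>n\<close>: independent sequences have length at
  most \<open>n\<close>, hence an arbitrary \<open>S\<close> has the closure of a finite independent sequence in \<open>S\<close>, which is
  shorter than \<open>n\<close> if \<open>S\<close> does not span. So exchange holds in general.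

  The division ring consists of additive relations on \<open>L\<close>. If \<open>a\<close> is a square matrix with
  \<open>a L\<^sup>n = L\<^sup>n\<close>, the formal expression \<open>f a\<^sup>-\<^sup>1 x\<close> becomes the total relation
  \<open>{(l, f w) | a w = x l}\<close>. These relations are closed under pointwise addition and composition, by
  block matrices, and two of them are identified if their intersection is total. The ring axioms then
  hold since in each of them one side contains the other. Exchange shows that a relation not
  identified with zero has a converse of the same form, and, combined with invariance of dimension,
  that the identification is transitive.
\<close>

subsection \<open>Closure operators of a module\<close>

text \<open>In a division ring generated by the image of R every element has the form f a^-1 x with
  a invertible, so these expressions are the natural candidates. The obstacle is that a may be onto
  L^n and still have a kernel: f a^-1 x is then multivalued, with indeterminacy f(ker a), and it is
  not an endomorphism of L. Cancellation yields only inclusions, such as 0 being contained in -g +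
  g, so the relations themselves do not form a ring. Passing to classes is delicate because two
  relations may each share values with a third one, but through different values. Exchange is
  required for every n since each sum, product or converse enlarges the matrix a. The formula for
  the converse is that of the Schur complement: f a^-1 x is the complement of a in the bordered
  matrix with rows (0, f) and (-x, a), so its inverse is the corner entry of the inverse of that
  matrix.\<close>

context left_module
begin

lemma scale_zero_right [simp]: "scale r 0 = 0"
  using scale_add_right[of r 0 0] by simp

lemma scale_zero_left [simp]: "scale 0 x = 0"
  using scale_add_left[of 0 0 x] by simp

lemma scale_minus_left [simp]: "scale (- r) x = - scale r x"
  using scale_add_left[of "- r" r x] by (simp add: eq_neg_iff_add_eq_0)

lemma scale_minus_right [simp]: "scale r (- x) = - scale r x"
  using scale_add_right[of r "- x" x] by (simp add: eq_neg_iff_add_eq_0)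

lemma scale_sum_right: "scale r (sum f A) = (\<Sum>a\<in>A. scale r (f a))"
  by (induction A rule: infinite_finite_induct) (simp_all add: scale_add_right)

lemma scale_sum_left: "scale (sum f A) x = (\<Sum>a\<in>A. scale (f a) x)"
  by (induction A rule: infinite_finite_induct) (simp_all add: scale_add_left)

text \<open>An element of sL is given by a single l in L, so a member of the sum is a finite family
  of coefficients \<open>w s\<close> in L. In this form sums of vectors turn into sums of
  entries.\<close>

lemma sum_times_module_iff:
  assumes S: "S \<subseteq> carrier_vec n"
  shows "v \<in> sum_times_module scale n S \<longleftrightarrow> v \<in> carrier_vec n \<and>
    (\<exists>F w. finite F \<and> F \<subseteq> S \<and> (\<forall>i<n. v $ i = (\<Sum>s\<in>F. scale (s $ i) (w s))))"
  (is "?l \<longleftrightarrow> ?r")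
proof
  assume ?l
  then obtain f F where F: "finite F" "F \<subseteq> S" "\<forall>s\<in>F. f s \<in> vec_times_module scale s"
    and v: "v = finsum_vec TYPE('l) n f F"
    by (auto simp: sum_times_module_def)
  from F(3) obtain w where w: "\<forall>s\<in>F. f s = map_vec (\<lambda>a. scale a (w s)) s"
    unfolding vec_times_module_def by simp metis
  have f: "f \<in> F \<rightarrow> carrier_vec n" using w F(2) S by auto
  show ?r
  proof (intro conjI exI allI impI)
    show "v \<in> carrier_vec n" unfolding v by (rule finsum_vec_closed[OF f])
    show "v $ i = (\<Sum>s\<in>F. scale (s $ i) (w s))" if "i < n" for i
      unfolding v index_finsum_vec[OF F(1) that f]
      by (rule sum.cong) (use w F(2) S that in \<open>auto dest!: subsetD\<close>)
  qed (use F in auto)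
next
  assume ?r
  then obtain F w where v: "v \<in> carrier_vec n" and F: "finite F" "F \<subseteq> S"
    and vi: "\<And>i. i < n \<Longrightarrow> v $ i = (\<Sum>s\<in>F. scale (s $ i) (w s))" by auto
  define f where "f s = map_vec (\<lambda>a. scale a (w s)) s" for s
  have f: "f \<in> F \<rightarrow> carrier_vec n" using F(2) S by (auto simp: f_def)
  have "v = finsum_vec TYPE('l) n f F"
  proof (rule eq_vecI)
    show "dim_vec v = dim_vec (finsum_vec TYPE('l) n f F)"
      using v finsum_vec_closed[OF f] by auto
    fix i assume "i < dim_vec (finsum_vec TYPE('l) n f F)"
    then have i: "i < n" using finsum_vec_closed[OF f] by auto
    show "v $ i = finsum_vec TYPE('l) n f F $ i"
      unfolding index_finsum_vec[OF F(1) i f] vi[OF i] f_def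
      by (rule sum.cong) (use F(2) S i in \<open>auto dest!: subsetD\<close>)
  qed
  moreover have "\<forall>s\<in>F. f s \<in> vec_times_module scale s"
    by (auto simp: f_def vec_times_module_def)
  ultimately show ?l using F unfolding sum_times_module_def by blast
qed

lemma vec_times_module_subset_sum_times_module:
  assumes "S \<subseteq> carrier_vec n" and "x \<in> S"
  shows "vec_times_module scale x \<subseteq> sum_times_module scale n S"
proof
  fix v assume "v \<in> vec_times_module scale x"
  then obtain l where v: "v = map_vec (\<lambda>a. scale a l) x" by (auto simp: vec_times_module_def)
  have x: "x \<in> carrier_vec n" using assms by auto
  show "v \<in> sum_times_module scale n S"
    unfolding sum_times_module_iff[OF assms(1)]
    using x assms(2) by (intro conjI exI[of _ "{x}"] exI[of _ "\<lambda>_. l"]) (auto simp: v)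
qed

lemma zero_in_sum_times_module: "0\<^sub>v n \<in> sum_times_module scale n S"
  unfolding sum_times_module_def by (auto simp: finsum_vec_empty intro!: exI[of _ "{}"])

lemma add_in_sum_times_module:
  assumes S: "S \<subseteq> carrier_vec n"
    and "u \<in> sum_times_module scale n S" "v \<in> sum_times_module scale n S"
  shows "u + v \<in> sum_times_module scale n S"
proof -
  from assms obtain F w G z where u: "u \<in> carrier_vec n" "finite F" "F \<subseteq> S"
      "\<And>i. i < n \<Longrightarrow> u $ i = (\<Sum>s\<in>F. scale (s $ i) (w s))"
    and v: "v \<in> carrier_vec n" "finite G" "G \<subseteq> S"
      "\<And>i. i < n \<Longrightarrow> v $ i = (\<Sum>s\<in>G. scale (s $ i) (z s))"
    by (auto simp: sum_times_module_iff[OF S])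
  \<comment> \<open>Both coefficient families are extended by 0 to the union, where they can be
    added.\<close>
  define y where "y s = (if s \<in> F then w s else 0) + (if s \<in> G then z s else 0)" for s
  have F: "(\<Sum>s\<in>F \<union> G. scale (s $ i) (if s \<in> F then w s else 0)) = (\<Sum>s\<in>F. scale (s $ i) (w s))" for i
    using u v by (intro sum.mono_neutral_cong_right) auto
  have G: "(\<Sum>s\<in>F \<union> G. scale (s $ i) (if s \<in> G then z s else 0)) = (\<Sum>s\<in>G. scale (s $ i) (z s))" for i
    using u v by (intro sum.mono_neutral_cong_right) auto
  show ?thesis
    unfolding sum_times_module_iff[OF S]
    using u v by (intro conjI exI[of _ "F \<union> G"] exI[of _ y])
      (auto simp: y_def scale_add_right sum.distrib F G simp del: sum.If_cases)
qed

text \<open>The sum is the subgroup generated by the sL. Each sL is closed under negation, so an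
  inclusion has to be tested with zero and sums only.\<close>

lemma sum_times_module_least:
  assumes S: "S \<subseteq> carrier_vec n"
    and sub: "\<And>s. s \<in> S \<Longrightarrow> vec_times_module scale s \<subseteq> G"
    and zero: "0\<^sub>v n \<in> G" and add: "\<And>u v. u \<in> G \<Longrightarrow> v \<in> G \<Longrightarrow> u + v \<in> G"
  shows "sum_times_module scale n S \<subseteq> G"
proof
  fix v assume "v \<in> sum_times_module scale n S"
  then obtain f F where F: "finite F" "F \<subseteq> S" "\<forall>s\<in>F. f s \<in> vec_times_module scale s"
    and v: "v = finsum_vec TYPE('l) n f F"
    by (auto simp: sum_times_module_def)
  have "finsum_vec TYPE('l) n f F \<in> G" using F
  proof (induction F)
    case empty
    then show ?case using zero by (simp add: finsum_vec_empty)
  next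
    case (insert s F)
    have f: "f t \<in> carrier_vec n" if "t \<in> insert s F" for t
    proof -
      have "t \<in> carrier_vec n" "f t \<in> vec_times_module scale t" using insert.prems that S by auto
      then show ?thesis by (auto simp: vec_times_module_def)
    qed
    have "finsum_vec TYPE('l) n f (insert s F) = f s + finsum_vec TYPE('l) n f F"
      by (rule finsum_vec_insert[OF insert.hyps(1,2)]) (use f in auto)
    moreover have "f s \<in> G" using insert.prems sub[of s] by auto
    moreover have "finsum_vec TYPE('l) n f F \<in> G" using insert.prems by (intro insert.IH) auto
    ultimately show ?case by (simp add: add)
  qed
  then show "v \<in> G" unfolding v .
qed

text \<open>Columns of a matrix may repeat, whereas the sum sees only the set of vectors. One
  direction is minimality of the sum; in the other the coefficients of all j with the same
  \<open>c j\<close> are collected into one.\<close>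

lemma sum_times_module_image_iff:
  assumes "finite J" and c: "\<And>j. j \<in> J \<Longrightarrow> c j \<in> carrier_vec n"
  shows "v \<in> sum_times_module scale n (c ` J) \<longleftrightarrow> v \<in> carrier_vec n \<and>
    (\<exists>w. \<forall>i<n. v $ i = (\<Sum>j\<in>J. scale (c j $ i) (w j)))"
  (is "?l \<longleftrightarrow> ?r")
proof
  assume ?l
  define G where "G = {v \<in> carrier_vec n. \<exists>w. \<forall>i<n. v $ i = (\<Sum>j\<in>J. scale (c j $ i) (w j))}"
  have "sum_times_module scale n (c ` J) \<subseteq> G"
  proof (rule sum_times_module_least)
    show "c ` J \<subseteq> carrier_vec n" using c by auto
    show "0\<^sub>v n \<in> G" unfolding G_def by (auto intro!: exI[of _ "\<lambda>_. 0"])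
  next
    fix s assume "s \<in> c ` J"
    then obtain j where j: "j \<in> J" "s = c j" by auto
    have "(\<Sum>k\<in>J. scale (c k $ i) (if k = j then l else 0)) = scale (c j $ i) l" for i l
      using assms(1) j by (subst sum.remove[of _ j]) (auto intro!: sum.neutral)
    then show "vec_times_module scale s \<subseteq> G"
      using c[OF j(1)] unfolding G_def vec_times_module_def
      by (force simp: j intro!: exI[of _ "\<lambda>k. if k = j then l else 0" for l])
  next
    fix u v assume "u \<in> G" "v \<in> G"
    then obtain w z where u: "u \<in> carrier_vec n" "\<forall>i<n. u $ i = (\<Sum>j\<in>J. scale (c j $ i) (w j))"
      and v: "v \<in> carrier_vec n" "\<forall>i<n. v $ i = (\<Sum>j\<in>J. scale (c j $ i) (z j))"
      by (auto simp: G_def)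
    then show "u + v \<in> G"
      by (auto simp: G_def scale_add_right sum.distrib intro!: exI[of _ "\<lambda>j. w j + z j"])
  qed
  with \<open>?l\<close> show ?r by (auto simp: G_def)
next
  assume ?r
  then obtain w where v: "v \<in> carrier_vec n"
    and w: "\<And>i. i < n \<Longrightarrow> v $ i = (\<Sum>j\<in>J. scale (c j $ i) (w j))" by auto
  define z where "z s = (\<Sum>j | j \<in> J \<and> c j = s. w j)" for s
  have "(\<Sum>j\<in>J. scale (c j $ i) (w j)) = (\<Sum>s\<in>c ` J. scale (s $ i) (z s))" for i
    unfolding z_def scale_sum_right using assms(1)
    by (subst sum.image_gen[where g = c]) (auto intro!: sum.cong)
  with w v assms(1) c show ?l
    by (subst sum_times_module_iff) (auto intro!: exI[of _ "c ` J"] exI[of _ z])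
qed

section \<open>The Galois connection and the closure axioms\<close>

lemma module_cl_carrier: "module_cl scale n S \<subseteq> carrier_vec n"
  by (auto simp: module_cl_def)

text \<open>The Galois connection between sets of vectors over R and subgroups of L^n: the closure
  is the composite of its two maps, so extensivity and idempotence follow formally.\<close>

lemma subset_module_cl_iff:
  assumes "S \<subseteq> carrier_vec n" "T \<subseteq> carrier_vec n"
  shows "T \<subseteq> module_cl scale n S \<longleftrightarrow> sum_times_module scale n T \<subseteq> sum_times_module scale n S"
proof
  assume "T \<subseteq> module_cl scale n S"
  then show "sum_times_module scale n T \<subseteq> sum_times_module scale n S"
    using assms by (intro sum_times_module_least zero_in_sum_times_module add_in_sum_times_module)
      (auto simp: module_cl_def)
next
  assume "sum_times_module scale n T \<subseteq> sum_times_module scale n S"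
  then show "T \<subseteq> module_cl scale n S"
    using assms vec_times_module_subset_sum_times_module[of T n] by (fastforce simp: module_cl_def)
qed

lemma sum_times_module_mono:
  assumes "S \<subseteq> T" "T \<subseteq> carrier_vec n"
  shows "sum_times_module scale n S \<subseteq> sum_times_module scale n T"
proof
  fix v assume "v \<in> sum_times_module scale n S"
  then obtain f F where "v = finsum_vec TYPE('l) n f F" "finite F" "F \<subseteq> S"
    "\<forall>s\<in>F. f s \<in> vec_times_module scale s"
    unfolding sum_times_module_def by blast
  moreover from this(3) assms(1) have "F \<subseteq> T" by (rule subset_trans)
  ultimately show "v \<in> sum_times_module scale n T" unfolding sum_times_module_def by blast
qed

lemma module_cl_mono:
  assumes "S \<subseteq> T" "T \<subseteq> carrier_vec n"
  shows "module_cl scale n S \<subseteq> module_cl scale n T"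
  using sum_times_module_mono[OF assms] unfolding module_cl_def by blast

lemma module_cl_extensive: "S \<subseteq> carrier_vec n \<Longrightarrow> S \<subseteq> module_cl scale n S"
  by (simp add: subset_module_cl_iff)

lemma sum_times_module_module_cl:
  assumes S: "S \<subseteq> carrier_vec n"
  shows "sum_times_module scale n (module_cl scale n S) = sum_times_module scale n S"
proof
  show "sum_times_module scale n (module_cl scale n S) \<subseteq> sum_times_module scale n S"
    by (simp add: subset_module_cl_iff[OF S module_cl_carrier, symmetric])
  show "sum_times_module scale n S \<subseteq> sum_times_module scale n (module_cl scale n S)"
    by (rule sum_times_module_mono[OF module_cl_extensive[OF S] module_cl_carrier])
qed

lemma module_cl_idem:
  assumes "S \<subseteq> carrier_vec n"
  shows "module_cl scale n (module_cl scale n S) = module_cl scale n S"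
  unfolding module_cl_def[of scale n "module_cl scale n S"] sum_times_module_module_cl[OF assms]
  by (rule module_cl_def[symmetric])

lemma closure_operator_module_cl: "closure_operator (carrier_vec n) (module_cl scale n)"
  unfolding closure_operator_def
  by (intro conjI allI impI module_cl_carrier module_cl_mono module_cl_extensive module_cl_idem)

text \<open>The operations on x move to the other factor: (x + y)l = xl + yl, (-x)l = x(-l) and
  (xr)l = x(rl), so that (xr)L lies in xL.\<close>

lemma right_submodule_module_cl:
  assumes "S \<subseteq> carrier_vec n"
  shows "right_submodule n (module_cl scale n S)"
  unfolding right_submodule_def
proof (intro conjI ballI allI)
  show "module_cl scale n S \<subseteq> carrier_vec n" by (rule module_cl_carrier)
  have "map_vec (\<lambda>a. scale a l) (0\<^sub>v n) = 0\<^sub>v n" for l by auto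
  then show "0\<^sub>v n \<in> module_cl scale n S"
    by (auto simp: module_cl_def vec_times_module_def zero_in_sum_times_module)
next
  fix x y assume xy: "x \<in> module_cl scale n S" "y \<in> module_cl scale n S"
  then have c: "x \<in> carrier_vec n" "y \<in> carrier_vec n" by (auto simp: module_cl_def)
  have "map_vec (\<lambda>a. scale a l) (x + y) = map_vec (\<lambda>a. scale a l) x + map_vec (\<lambda>a. scale a l) y" for l
    using c by (auto simp: scale_add_left)
  with xy show "x + y \<in> module_cl scale n S"
    by (auto simp: module_cl_def vec_times_module_def intro!: add_in_sum_times_module[OF assms])
next
  fix x assume x: "x \<in> module_cl scale n S"
  have "map_vec (\<lambda>a. scale a l) (- x) = map_vec (\<lambda>a. scale a (- l)) x" for l
    by auto
  then have "vec_times_module scale (- x) \<subseteq> vec_times_module scale x"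
    unfolding vec_times_module_def by blast
  with x show "- x \<in> module_cl scale n S" by (auto simp: module_cl_def)
  fix r
  have "map_vec (\<lambda>a. scale a l) (rsmult x r) = map_vec (\<lambda>a. scale a (scale r l)) x" for l
    by (auto simp: rsmult_def scale_scale)
  then have "vec_times_module scale (rsmult x r) \<subseteq> vec_times_module scale x"
    by (auto simp: vec_times_module_def)
  moreover have "rsmult x r \<in> carrier_vec n" using x by (auto simp: module_cl_def rsmult_def)
  ultimately show "rsmult x r \<in> module_cl scale n S" using x
    by (auto simp: module_cl_def)
qed

end

section \<open>Right module homomorphisms as matrices, and inverse images\<close>

lemma right_module_hom_index:
  fixes h :: "'r::ring_1 vec \<Rightarrow> 'r vec"
  assumes h: "right_module_hom m n h" and x: "x \<in> carrier_vec m" and i: "i < n"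
  shows "h x $ i = (\<Sum>j<m. h (unit_vec m j) $ i * x $ j)"
proof -
  have add: "h (y + z) = h y + h z" if "y \<in> carrier_vec m" "z \<in> carrier_vec m" for y z
    using h that by (auto simp: right_module_hom_def)
  have smult: "h (rsmult y r) = rsmult (h y) r" if "y \<in> carrier_vec m" for y r
    using h that by (auto simp: right_module_hom_def)
  have car: "h y \<in> carrier_vec n" if "y \<in> carrier_vec m" for y
    using h that by (auto simp: right_module_hom_def)
  \<comment> \<open>\<open>t k\<close> keeps the first k coordinates of x, so that right linearity
    brings in one column h(e_j) x_j at a time.\<close>
  define t where "t k = vec m (\<lambda>j. if j < k then x $ j else 0)" for k
  have t: "t k \<in> carrier_vec m" for k by (simp add: t_def)
  have "h (t k) $ i = (\<Sum>j<k. h (unit_vec m j) $ i * x $ j)" if "k \<le> m" for k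
    using that
  proof (induction k)
    case 0
    \<comment> \<open>Zero is a multiple by 0, so compatibility with scalars alone gives h(0) =
      0.\<close>
    have "t 0 = rsmult (0\<^sub>v m) 0" by (auto simp: t_def rsmult_def)
    then have "h (t 0) = rsmult (h (0\<^sub>v m)) 0" by (simp add: smult)
    then show ?case using car[of "0\<^sub>v m"] i by (simp add: rsmult_def)
  next
    case (Suc k)
    have "t (Suc k) = t k + rsmult (unit_vec m k) (x $ k)"
      using Suc.prems by (intro eq_vecI) (auto simp: t_def rsmult_def less_Suc_eq)
    moreover have "rsmult (unit_vec m k) (x $ k) \<in> carrier_vec m" by (simp add: rsmult_def)
    ultimately have "h (t (Suc k)) = h (t k) + rsmult (h (unit_vec m k)) (x $ k)"
      using t[of k] by (simp add: add smult)
    then show ?case using Suc car[of "unit_vec m k"] i by (simp add: rsmult_def)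
  qed
  moreover have "t m = x" using x by (auto simp: t_def)
  ultimately show ?thesis by (metis le_refl)
qed

text \<open>The matrix of h also acts on columns over L, as an additive map \<open>H\<close> with
  H(xl) = h(x)l. The inverse image under \<open>H\<close> of the sum over A is a subgroup containing
  every xL with h(x) in A, hence the sum of these.\<close>

lemma (in left_module) closed_subset_vimage_right_module_hom:
  assumes h: "right_module_hom m n h"
    and A: "closed_subset (carrier_vec n) (module_cl scale n) A"
  shows "closed_subset (carrier_vec m) (module_cl scale m) {x \<in> carrier_vec m. h x \<in> A}"
proof -
  let ?B = "{x \<in> carrier_vec m. h x \<in> A}"
  define H where "H v = vec n (\<lambda>i. \<Sum>j<m. scale (h (unit_vec m j) $ i) (v $ j))" for v
  have A': "A \<subseteq> carrier_vec n" "module_cl scale n A = A" using A by (auto simp: closed_subset_def)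
  have car: "h y \<in> carrier_vec n" if "y \<in> carrier_vec m" for y
    using h that by (auto simp: right_module_hom_def)
  have H: "H (map_vec (\<lambda>a. scale a l) x) = map_vec (\<lambda>a. scale a l) (h x)"
    if "x \<in> carrier_vec m" for x l
    using that car[OF that]
    by (intro eq_vecI) (auto simp: H_def right_module_hom_index[OF h that] scale_sum_left scale_scale
        intro!: sum.cong)
  have *: "sum_times_module scale m ?B \<subseteq> {v \<in> carrier_vec m. H v \<in> sum_times_module scale n A}"
    (is "_ \<subseteq> ?G")
  proof (rule sum_times_module_least)
    fix s assume s: "s \<in> ?B"
    then show "vec_times_module scale s \<subseteq> ?G"
      using vec_times_module_subset_sum_times_module[OF A'(1), of "h s"]
      by (auto simp: vec_times_module_def H)
  next
    have "H (0\<^sub>v m) = 0\<^sub>v n" by (auto simp: H_def)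
    then show "0\<^sub>v m \<in> ?G" by (simp add: zero_in_sum_times_module)
  next
    fix u v assume uv: "u \<in> ?G" "v \<in> ?G"
    then have "H (u + v) = H u + H v" by (auto simp: H_def scale_add_right sum.distrib)
    with uv show "u + v \<in> ?G" by (auto intro!: add_in_sum_times_module[OF A'(1)])
  qed auto
  have "x \<in> ?B" if x: "x \<in> module_cl scale m ?B" for x
  proof -
    have xc: "x \<in> carrier_vec m" using x by (auto simp: module_cl_def)
    have "map_vec (\<lambda>a. scale a l) (h x) \<in> sum_times_module scale n A" for l
      using x * by (auto simp: module_cl_def vec_times_module_def H[OF xc, symmetric])
    then have "h x \<in> module_cl scale n A"
      using car[OF xc] by (auto simp: module_cl_def vec_times_module_def)
    with xc A'(2) show ?thesis by simp
  qed
  moreover have "?B \<subseteq> module_cl scale m ?B" by (rule module_cl_extensive) auto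
  ultimately have "module_cl scale m ?B = ?B" by blast
  then show ?thesis unfolding closed_subset_def by blast
qed

locale nonzero_left_module = left_module scale
  for scale :: "'r::ring_1 \<Rightarrow> 'l::ab_group_add \<Rightarrow> 'l" +
  assumes nonzero: "\<exists>l::'l. l \<noteq> 0"
begin

lemma unit_vec_notin_module_cl_empty:
  assumes "i < n"
  shows "unit_vec n i \<notin> module_cl scale n {}"
proof
  assume "unit_vec n i \<in> module_cl scale n {}"
  moreover have "sum_times_module scale n {} = {0\<^sub>v n}"
    by (auto simp: sum_times_module_def finsum_vec_empty)
  ultimately have *: "map_vec (\<lambda>a. scale a l) (unit_vec n i) = 0\<^sub>v n" for l
    by (auto simp: module_cl_def vec_times_module_def)
  have "l = 0" for l :: 'l
    using arg_cong[OF *[of l], of "\<lambda>v. v $ i"] assms(1) by (simp add: scale_one)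
  with nonzero show False by blast
qed

end

subsection \<open>Steinitz exchange and the chain conditions\<close>

text \<open>Independence is tested only against the preceding entries. Before exchange is known this
  notion depends on the order, but it is the one preserved by appending a vector outside the
  closure.\<close>

definition independent_list :: "('a set \<Rightarrow> 'a set) \<Rightarrow> 'a list \<Rightarrow> bool" where
  "independent_list cl vs \<longleftrightarrow> (\<forall>i<length vs. vs ! i \<notin> cl (set (take i vs)))"

lemma independent_list_Nil [simp]: "independent_list cl []"
  by (simp add: independent_list_def)

lemma independent_list_snoc [simp]:
  "independent_list cl (vs @ [v]) \<longleftrightarrow> independent_list cl vs \<and> v \<notin> cl (set vs)"
  by (auto simp: independent_list_def nth_append less_Suc_eq)

text \<open>The spanning set is a list because its length, counted with repetitions, serves as the
  bound. It is used twice: with the unit vectors to prove exchange, and with the columns of a matrix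
  to prove invariance of dimension.\<close>

locale spanned_closure =
  fixes X :: "'a set" and cl :: "'a set \<Rightarrow> 'a set" and es :: "'a list"
  assumes cl: "closure_operator X cl"
    and es: "set es \<subseteq> X" "X \<subseteq> cl (set es)"
    and small_exchange: "\<And>S t u. S \<subseteq> X \<Longrightarrow> finite S \<Longrightarrow> card S < length es \<Longrightarrow> t \<in> X \<Longrightarrow> u \<in> X \<Longrightarrow>
      u \<notin> cl S \<Longrightarrow> u \<in> cl (S \<union> {t}) \<Longrightarrow> t \<in> cl (S \<union> {u})"
begin

lemma cl_mono: "S \<subseteq> T \<Longrightarrow> T \<subseteq> X \<Longrightarrow> cl S \<subseteq> cl T"
  using cl unfolding closure_operator_def by (meson order_trans)

lemma cl_extensive: "S \<subseteq> X \<Longrightarrow> S \<subseteq> cl S"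
  using cl unfolding closure_operator_def by blast

lemma cl_least: "S \<subseteq> cl T \<Longrightarrow> T \<subseteq> X \<Longrightarrow> cl S \<subseteq> cl T"
  using cl unfolding closure_operator_def by (metis order_trans)

text \<open>Replacement: the first k entries of \<open>vs\<close> displace k entries of
  \<open>es\<close>, and together with the remaining list \<open>E\<close> they still span. The
  invariant \<open>k + length E = length es\<close> then gives the bound.\<close>

lemma Steinitz:
  assumes vs: "set vs \<subseteq> X" "independent_list cl vs"
  shows "length vs \<le> length es"
proof -
  have "\<exists>E. set E \<subseteq> X \<and> k + length E = length es \<and> X \<subseteq> cl (set (take k vs) \<union> set E)"
    if "k \<le> length vs" for k
    using that
  proof (induction k)
    case 0
    then show ?case using es by auto
  next
    case (Suc k)
    then obtain E where E: "set E \<subseteq> X" "k + length E = length es"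
      "X \<subseteq> cl (set (take k vs) \<union> set E)" by auto
    define V where "V = set (take k vs)"
    define v where "v = vs ! k"
    have V: "V \<subseteq> X" using vs set_take_subset by (fastforce simp: V_def)
    have v: "v \<in> X" "v \<notin> cl V"
      using vs Suc.prems by (auto simp: v_def V_def independent_list_def)
    have Vv: "set (take (Suc k) vs) = insert v V"
      using Suc.prems by (simp add: take_Suc_conv_app_nth v_def V_def)
    \<comment> \<open>The shortest prefix of \<open>E\<close> that captures v together with V. Since
      the next shorter prefix misses v, the last entry e of this one can be exchanged for v.\<close>
    define j where "j = (LEAST j. v \<in> cl (V \<union> set (take j E)))"
    have j: "v \<in> cl (V \<union> set (take j E))"
      unfolding j_def by (rule LeastI[of _ "length E"]) (use E v in \<open>auto simp: V_def\<close>)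
    have j_le: "j \<le> length E"
      unfolding j_def by (rule Least_le) (use E v in \<open>auto simp: V_def\<close>)
    have "j \<noteq> 0" using j v(2) by (cases j) auto
    then obtain i where i: "j = Suc i" by (cases j) auto
    have vi: "v \<notin> cl (V \<union> set (take i E))"
      using not_less_Least[of i "\<lambda>j. v \<in> cl (V \<union> set (take j E))"] by (simp add: j_def[symmetric] i)
    define e where "e = E ! i"
    define E' where "E' = take i E @ drop (Suc i) E"
    have E_eq: "E = take i E @ e # drop (Suc i) E"
      using j_le i by (simp add: e_def id_take_nth_drop)
    have take_j: "set (take j E) = set (take i E) \<union> {e}"
      using j_le by (simp add: i take_Suc_conv_app_nth e_def)
    have sets: "set (take i E) \<subseteq> set E'" "set E' \<subseteq> set E" "set E = insert e (set E')"
      by (auto simp: E'_def) (use arg_cong[OF E_eq, of set] in \<open>auto dest: in_set_takeD in_set_dropD\<close>)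
    have e: "e \<in> X" using sets E by auto
    \<comment> \<open>The base of the exchange has at most k + i elements, and i < length E = length
      es - k. This keeps it in the range of \<open>small_exchange\<close>.\<close>
    have "card V \<le> k" using card_length[of "take k vs"] by (auto simp: V_def)
    moreover have "card (set (take i E)) \<le> i" using card_length[of "take i E"] by auto
    ultimately have "card (V \<union> set (take i E)) < length es"
      using card_Un_le[of V "set (take i E)"] E(2) j_le i by linarith
    moreover have W: "V \<union> set (take i E) \<subseteq> X" "finite (V \<union> set (take i E))"
      using V E(1) sets by (auto simp: V_def)
    moreover have "v \<in> cl (V \<union> set (take i E) \<union> {e})"
      using j unfolding take_j by (simp only: Un_assoc)
    ultimately have e': "e \<in> cl (V \<union> set (take i E) \<union> {v})"
      by (intro small_exchange[OF _ _ _ e v(1) vi])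
    have X: "insert v V \<union> set E' \<subseteq> X" using V v(1) E(1) sets(2) by auto
    have "cl (V \<union> set (take i E) \<union> {v}) \<subseteq> cl (insert v V \<union> set E')"
      by (rule cl_mono[OF _ X]) (use sets(1) in auto)
    then have "V \<union> set E \<subseteq> cl (insert v V \<union> set E')"
      using cl_extensive[OF X] sets(3) e' by auto
    then have "cl (V \<union> set E) \<subseteq> cl (insert v V \<union> set E')"
      using X by (rule cl_least)
    moreover have "Suc (length E') = length E" using j_le i by (auto simp: E'_def)
    ultimately show ?case
      using E sets by (intro exI[of _ E']) (auto simp: Vv V_def[symmetric])
  qed
  from this[of "length vs"] show ?thesis by auto
qed

lemma exchange: "exchange_property X cl"
  unfolding exchange_property_def
proof (intro allI impI)
  fix S t u
  assume S: "S \<subseteq> X" and t: "t \<in> X" and u: "u \<in> X" "u \<notin> cl S" "u \<in> cl (S \<union> {t})"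
  let ?P = "\<lambda>vs. set vs \<subseteq> S \<and> independent_list cl vs"
  obtain vs where vs: "?P vs" and max: "\<And>ws. ?P ws \<Longrightarrow> length ws \<le> length vs"
    using ex_has_greatest_nat[of ?P "[]" length "Suc (length es)"] Steinitz S
    by (metis empty_subsetI independent_list_Nil le_imp_less_Suc list.set(1) order_trans)
  have "s \<in> cl (set vs)" if "s \<in> S" for s
    using max[of "vs @ [s]"] vs that by auto
  then have S': "S \<subseteq> cl (set vs)" by auto
  \<comment> \<open>The vector u extends \<open>vs\<close> independently, so \<open>vs\<close> is
    strictly shorter than \<open>es\<close> and exchange over \<open>set vs\<close> is
    available.\<close>
  have uvs: "u \<notin> cl (set vs)" using cl_mono[of "set vs" S] vs u S by auto
  then have "length (vs @ [u]) \<le> length es" using vs u S by (intro Steinitz) auto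
  then have "card (set vs) < length es" using card_length[of vs] by auto
  moreover have "S \<union> {t} \<subseteq> cl (set vs \<union> {t})"
    using S' cl_mono[of "set vs" "set vs \<union> {t}"] cl_extensive[of "set vs \<union> {t}"] vs S t by auto
  then have "u \<in> cl (set vs \<union> {t})" using u cl_least[of "S \<union> {t}" "set vs \<union> {t}"] vs S t by auto
  moreover have "set vs \<subseteq> X" using vs S by blast
  ultimately have "t \<in> cl (set vs \<union> {u})"
    using uvs t u(1) small_exchange[of "set vs" t u] by blast
  moreover have "cl (set vs \<union> {u}) \<subseteq> cl (S \<union> {u})" using vs S u(1) by (intro cl_mono) auto
  ultimately show "t \<in> cl (S \<union> {u})" by blast
qed

end

section \<open>Exchange, chains of sums and matrix images\<close>

lemma no_added_column_chainD:
  assumes "no_added_column_chain scale n" "n > 0"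
    and "A \<in> carrier_mat n (n - 1)" "B \<in> carrier_mat n n" "C \<in> carrier_mat n n"
    and "adds_column A B" "adds_column A C"
  shows "\<not> (mat_image scale A \<subset> mat_image scale B \<and> mat_image scale B \<subset> mat_image scale C)"
  using assms unfolding no_added_column_chain_def by blast

lemma no_changed_column_chainD:
  assumes "no_changed_column_chain scale n"
    and "A \<in> carrier_mat n n" "B \<in> carrier_mat n n" "C \<in> carrier_mat n n"
    and "j < n" "\<And>k. k < n \<Longrightarrow> k \<noteq> j \<Longrightarrow> col A k = col B k \<and> col B k = col C k"
  shows "\<not> (mat_image scale A \<subset> mat_image scale B \<and> mat_image scale B \<subset> mat_image scale C)"
  using assms unfolding no_changed_column_chain_def by blast

context left_module
begin

lemma in_module_cl_iff:
  assumes "S \<subseteq> carrier_vec n" "x \<in> carrier_vec n"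
  shows "x \<in> module_cl scale n S \<longleftrightarrow>
    sum_times_module scale n (S \<union> {x}) = sum_times_module scale n S"
proof
  assume "x \<in> module_cl scale n S"
  then have "S \<union> {x} \<subseteq> module_cl scale n S" using module_cl_extensive[OF assms(1)] by auto
  then have "sum_times_module scale n (S \<union> {x}) \<subseteq> sum_times_module scale n S"
    using assms by (subst subset_module_cl_iff[symmetric]) auto
  then show "sum_times_module scale n (S \<union> {x}) = sum_times_module scale n S"
    using sum_times_module_mono[of S "S \<union> {x}" n] assms by auto
next
  assume "sum_times_module scale n (S \<union> {x}) = sum_times_module scale n S"
  then have "S \<union> {x} \<subseteq> module_cl scale n S"
    using assms by (subst subset_module_cl_iff) auto
  then show "x \<in> module_cl scale n S" by auto
qed

text \<open>A violation of exchange is the same thing as a chain: u lying in the closure of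
  \<open>S \<union> {t}\<close> is the second inclusion, t not lying in that of
  \<open>S \<union> {u}\<close> makes it strict, and u being outside the closure of S makes the
  first one strict.\<close>

lemma exchange_failure_iff_chain:
  assumes "S \<subseteq> carrier_vec n" "t \<in> carrier_vec n" "u \<in> carrier_vec n"
  shows "u \<notin> module_cl scale n S \<and> u \<in> module_cl scale n (S \<union> {t}) \<and> t \<notin> module_cl scale n (S \<union> {u})
    \<longleftrightarrow> sum_times_module scale n S \<subset> sum_times_module scale n (S \<union> {u}) \<and>
        sum_times_module scale n (S \<union> {u}) \<subset> sum_times_module scale n (S \<union> {t})"
proof -
  let ?V = "sum_times_module scale n"
  have 1: "u \<in> module_cl scale n (S \<union> {t}) \<longleftrightarrow> ?V (S \<union> {u}) \<subseteq> ?V (S \<union> {t})"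
    if "t \<in> carrier_vec n" "u \<in> carrier_vec n" for t u
    using that assms(1) module_cl_extensive[of "S \<union> {t}" n]
    by (subst subset_module_cl_iff[symmetric]) auto
  have "?V S \<subseteq> ?V (S \<union> {u})" using assms by (intro sum_times_module_mono) auto
  then show ?thesis
    using 1[OF assms(2,3)] 1[OF assms(3,2)] in_module_cl_iff[OF assms(1,3)] by auto
qed

lemma exchange_property_iff_no_vector_chain:
  "exchange_property (carrier_vec n) (module_cl scale n) \<longleftrightarrow> no_vector_chain scale n"
  (is "?E \<longleftrightarrow> ?N")
proof
  assume ?E
  then show ?N
    unfolding no_vector_chain_def exchange_property_def
    using exchange_failure_iff_chain by metis
next
  assume N: ?N
  show ?E
    unfolding exchange_property_def
  proof (intro allI impI)
    fix S t u
    assume "S \<subseteq> carrier_vec n" "t \<in> carrier_vec n" "u \<in> carrier_vec n"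
      "u \<notin> module_cl scale n S" "u \<in> module_cl scale n (S \<union> {t})"
    moreover from this(1-3) have "\<not> (sum_times_module scale n S \<subset> sum_times_module scale n (S \<union> {u}) \<and>
        sum_times_module scale n (S \<union> {u}) \<subset> sum_times_module scale n (S \<union> {t}))"
      using N unfolding no_vector_chain_def by metis
    ultimately show "t \<in> module_cl scale n (S \<union> {u})"
      using exchange_failure_iff_chain[of S n t u] by meson
  qed
qed

text \<open>The image is the sum of the subgroups cL over the columns c, so the matrix conditions
  depend only on sets of columns.\<close>

lemma mat_image_eq_sum_times_module:
  assumes "dim_row A = n"
  shows "mat_image scale A = sum_times_module scale n (set (cols A))"
proof -
  have cols: "set (cols A) = col A ` {..<dim_col A}" by (auto simp: cols_def)
  have "v \<in> mat_image scale A \<longleftrightarrow> v \<in> carrier_vec n \<and>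
    (\<exists>w. \<forall>i<n. v $ i = (\<Sum>j<dim_col A. scale (col A j $ i) (w j)))" (is "?l \<longleftrightarrow> ?r") for v
  proof
    assume ?l
    then show ?r using assms by (auto simp: mat_image_def mat_times_vec_def)
  next
    assume ?r
    then obtain w where "v \<in> carrier_vec n"
      "\<forall>i<n. v $ i = (\<Sum>j<dim_col A. scale (col A j $ i) (w j))" by auto
    then have "v = mat_times_vec scale A (vec (dim_col A) w)"
      using assms by (auto simp: mat_times_vec_def intro!: eq_vecI)
    then show ?l unfolding mat_image_def by auto
  qed
  then show ?thesis
    unfolding cols using assms by (subst set_eq_iff, subst sum_times_module_image_iff) auto
qed

lemma unit_vecs_span:
  "carrier_vec n \<subseteq> module_cl scale n (set (map (unit_vec n) [0..<n]))"
proof -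
  have "v \<in> sum_times_module scale n (unit_vec n ` {..<n})" if v: "v \<in> carrier_vec n" for v
  proof -
    have "v $ i = (\<Sum>j<n. scale (unit_vec n j $ i) (v $ j))" if "i < n" for i
      using that by (subst sum.remove[of _ i]) (auto simp: scale_one intro!: sum.neutral)
    then show ?thesis using v by (subst sum_times_module_image_iff) auto
  qed
  then show ?thesis
    by (auto simp: module_cl_def vec_times_module_def atLeast0LessThan)
qed

text \<open>The bound n is the number of unit vectors in the spanning list. It matches what n x n
  matrices can express: up to n - 1 columns for S and one for the added vector.\<close>

lemma exchange_property_if_small:
  assumes "\<And>S t u. S \<subseteq> carrier_vec n \<Longrightarrow> finite S \<Longrightarrow> card S < n \<Longrightarrow>
      t \<in> carrier_vec n \<Longrightarrow> u \<in> carrier_vec n \<Longrightarrow>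
      \<not> (sum_times_module scale n S \<subset> sum_times_module scale n (S \<union> {u}) \<and>
         sum_times_module scale n (S \<union> {u}) \<subset> sum_times_module scale n (S \<union> {t}))"
  shows "exchange_property (carrier_vec n) (module_cl scale n)"
proof -
  interpret spanned_closure "carrier_vec n" "module_cl scale n" "map (unit_vec n) [0..<n]"
  proof
    fix S t u
    assume "S \<subseteq> carrier_vec n" "finite S" "card S < length (map (unit_vec n :: _ \<Rightarrow> 'r vec) [0..<n])"
      "t \<in> carrier_vec n" "u \<in> carrier_vec n" "u \<notin> module_cl scale n S"
      "u \<in> module_cl scale n (S \<union> {t})"
    then show "t \<in> module_cl scale n (S \<union> {u})"
      using assms[of S t u] exchange_failure_iff_chain[of S n t u] by auto
  qed (use closure_operator_module_cl unit_vecs_span in auto)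
  show ?thesis by (rule exchange)
qed

lemma sum_times_module_insert_zero:
  assumes "S \<subseteq> carrier_vec n"
  shows "sum_times_module scale n (insert (0\<^sub>v n) S) = sum_times_module scale n S"
proof -
  have "0\<^sub>v n \<in> module_cl scale n S"
    using right_submodule_module_cl[OF assms] by (simp add: right_submodule_def)
  then show ?thesis using in_module_cl_iff[OF assms, of "0\<^sub>v n"] by simp
qed

text \<open>S may have fewer elements than the matrix has columns to fill; zero columns make up the
  difference without changing any sum.\<close>

lemma obtain_padded_list:
  assumes S: "S \<subseteq> carrier_vec n" "finite S" "card S \<le> k"
  obtains vs where "length vs = k" "set vs \<subseteq> carrier_vec n"
    "\<And>T. T \<subseteq> carrier_vec n \<Longrightarrow>
      sum_times_module scale n (set vs \<union> T) = sum_times_module scale n (S \<union> T)"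
proof -
  obtain xs where xs: "set xs = S" "distinct xs" using finite_distinct_list[OF S(2)] by auto
  define vs where "vs = xs @ replicate (k - card S) (0\<^sub>v n)"
  have "set vs = S \<or> set vs = insert (0\<^sub>v n) S" by (auto simp: vs_def xs)
  moreover have "length vs = k" using xs S(3) distinct_card[OF xs(2)] by (simp add: vs_def)
  moreover have "sum_times_module scale n (insert (0\<^sub>v n) S \<union> T) = sum_times_module scale n (S \<union> T)"
    if "T \<subseteq> carrier_vec n" for T
    using that S sum_times_module_insert_zero[of "S \<union> T" n] by simp
  ultimately show ?thesis using S(1) that[of vs] by (metis insert_subset zero_carrier_vec)
qed

lemma no_added_column_chain_if_no_vector_chain:
  assumes "no_vector_chain scale n"
  shows "no_added_column_chain scale n"
  unfolding no_added_column_chain_def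
proof (intro impI notI)
  assume "\<exists>A B C. A \<in> carrier_mat n (n - 1) \<and> B \<in> carrier_mat n n \<and> C \<in> carrier_mat n n \<and>
          adds_column A B \<and> adds_column A C \<and>
          mat_image scale A \<subset> mat_image scale B \<and> mat_image scale B \<subset> mat_image scale C"
  then obtain A B C where A: "A \<in> carrier_mat n (n - 1)" and B: "B \<in> carrier_mat n n"
    and C: "C \<in> carrier_mat n n" and add: "adds_column A B" "adds_column A C"
    and *: "mat_image scale A \<subset> mat_image scale B" "mat_image scale B \<subset> mat_image scale C" by blast
  \<comment> \<open>Wherever the new column is inserted, the set of columns gains just this
    vector.\<close>
  have added: "\<exists>v\<in>carrier_vec n. set (cols D) = set (cols A) \<union> {v}"
    if D: "D \<in> carrier_mat n n" "adds_column A D" for D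
  proof -
    from D(2) obtain j v where "cols D = take j (cols A) @ v # drop j (cols A)"
      by (auto simp: adds_column_def)
    then have "set (cols D) = set (take j (cols A) @ drop j (cols A)) \<union> {v}"
      by (auto simp del: append_take_drop_id)
    then have "set (cols D) = set (cols A) \<union> {v}" by (simp only: append_take_drop_id)
    moreover have "set (cols D) \<subseteq> carrier_vec n" using D(1) cols_dim[of D] by auto
    ultimately show ?thesis by auto
  qed
  from added[OF B add(1)] added[OF C add(2)] obtain u t where "u \<in> carrier_vec n" "t \<in> carrier_vec n"
    "set (cols B) = set (cols A) \<union> {u}" "set (cols C) = set (cols A) \<union> {t}" by auto
  moreover have "set (cols A) \<subseteq> carrier_vec n" using A cols_dim[of A] by auto
  ultimately show False
    using assms * A B C mat_image_eq_sum_times_module[of A n] mat_image_eq_sum_times_module[of B n]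
      mat_image_eq_sum_times_module[of C n]
    unfolding no_vector_chain_def by (metis carrier_matD(1))
qed

text \<open>Let S consist of the common columns. The image of A contains the sum over S, so the
  chain remains strict with S in place of A.\<close>

lemma no_changed_column_chain_if_no_vector_chain:
  assumes "no_vector_chain scale n"
  shows "no_changed_column_chain scale n"
  unfolding no_changed_column_chain_def
proof
  assume "\<exists>A B C. A \<in> carrier_mat n n \<and> B \<in> carrier_mat n n \<and> C \<in> carrier_mat n n \<and>
          (\<exists>j<n. \<forall>k<n. k \<noteq> j \<longrightarrow> col A k = col B k \<and> col B k = col C k) \<and>
          mat_image scale A \<subset> mat_image scale B \<and> mat_image scale B \<subset> mat_image scale C"
  then obtain A B C j where A: "A \<in> carrier_mat n n" and B: "B \<in> carrier_mat n n"
    and C: "C \<in> carrier_mat n n" and j: "j < n"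
    and same: "\<And>k. k < n \<Longrightarrow> k \<noteq> j \<Longrightarrow> col A k = col B k \<and> col B k = col C k"
    and *: "mat_image scale A \<subset> mat_image scale B" "mat_image scale B \<subset> mat_image scale C" by blast
  define S where "S = col A ` ({..<n} - {j})"
  have S: "S \<subseteq> carrier_vec n" using A by (auto simp: S_def)
  have img: "mat_image scale D = sum_times_module scale n (S \<union> {col D j})"
    if D: "D \<in> carrier_mat n n" "\<And>k. k < n \<Longrightarrow> k \<noteq> j \<Longrightarrow> col D k = col A k" for D
  proof -
    have "set (cols D) = col D ` insert j ({..<n} - {j})"
      using D(1) j by (auto simp: cols_def insert_absorb)
    also have "col D ` ({..<n} - {j}) = S"
      unfolding S_def by (rule image_cong) (use D(2) in auto)
    then have "col D ` insert j ({..<n} - {j}) = S \<union> {col D j}" by auto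
    finally show ?thesis using D(1) by (simp add: mat_image_eq_sum_times_module[of D n])
  qed
  let ?V = "\<lambda>T. sum_times_module scale n T"
  have chain: "?V (S \<union> {col A j}) \<subset> ?V (S \<union> {col B j})" "?V (S \<union> {col B j}) \<subset> ?V (S \<union> {col C j})"
    using * img[OF A] img[OF B] img[OF C] same by auto
  have "?V S \<subseteq> ?V (S \<union> {col A j})" using S A j by (intro sum_times_module_mono) auto
  then have "?V S \<subset> ?V (S \<union> {col B j})" using chain(1) by auto
  moreover have "col B j \<in> carrier_vec n" "col C j \<in> carrier_vec n" using B C by auto
  ultimately show False using S chain(2) assms unfolding no_vector_chain_def by blast
qed

lemma exchange_property_if_no_added_column_chain:
  assumes "no_added_column_chain scale n"
  shows "exchange_property (carrier_vec n) (module_cl scale n)"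
proof (rule exchange_property_if_small)
  fix S :: "'r vec set" and t u :: "'r vec"
  assume S: "S \<subseteq> carrier_vec n" "finite S" "card S < n"
    and tu: "t \<in> carrier_vec n" "u \<in> carrier_vec n"
  from S(3) have "card S \<le> n - 1" by simp
  then obtain vs where vs: "length vs = n - 1" "set vs \<subseteq> carrier_vec n"
    and eq: "\<And>T. T \<subseteq> carrier_vec n \<Longrightarrow>
      sum_times_module scale n (set vs \<union> T) = sum_times_module scale n (S \<union> T)"
    by (rule obtain_padded_list[OF S(1,2)]) blast
  let ?A = "mat_of_cols n vs"
  have add: "adds_column ?A (mat_of_cols n (vs @ [v]))" if "v \<in> carrier_vec n" for v
    using that vs unfolding adds_column_def
    by (auto intro!: exI[of _ "length vs"])
  have img: "mat_image scale (mat_of_cols n (vs @ [v])) = sum_times_module scale n (S \<union> {v})"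
    if "v \<in> carrier_vec n" for v
    using that vs eq[of "{v}"] by (simp add: mat_image_eq_sum_times_module[of _ n])
  have imgA: "mat_image scale ?A = sum_times_module scale n S"
    using vs eq[of "{}"] by (simp add: mat_image_eq_sum_times_module[of _ n])
  have "?A \<in> carrier_mat n (n - 1)" "mat_of_cols n (vs @ [v]) \<in> carrier_mat n n" for v
    using mat_of_cols_carrier(1)[of n vs] mat_of_cols_carrier(1)[of n "vs @ [v]"] vs(1) S(3)
    by simp_all
  then show "\<not> (sum_times_module scale n S \<subset> sum_times_module scale n (S \<union> {u}) \<and>
         sum_times_module scale n (S \<union> {u}) \<subset> sum_times_module scale n (S \<union> {t}))"
    using no_added_column_chainD[OF assms, of ?A "mat_of_cols n (vs @ [u])" "mat_of_cols n (vs @ [t])"]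
      S(3) add[OF tu(1)] add[OF tu(2)] imgA img[OF tu(1)] img[OF tu(2)] by simp
qed

text \<open>With the zero vector as its last column, the smallest matrix is n x n and still has the
  sum over S as image.\<close>

lemma exchange_property_if_no_changed_column_chain:
  assumes "no_changed_column_chain scale n"
  shows "exchange_property (carrier_vec n) (module_cl scale n)"
proof (rule exchange_property_if_small)
  fix S :: "'r vec set" and t u :: "'r vec"
  assume S: "S \<subseteq> carrier_vec n" "finite S" "card S < n"
    and tu: "t \<in> carrier_vec n" "u \<in> carrier_vec n"
  from S(3) have "card S \<le> n - 1" by simp
  then obtain vs where vs: "length vs = n - 1" "set vs \<subseteq> carrier_vec n"
    and eq: "\<And>T. T \<subseteq> carrier_vec n \<Longrightarrow>
      sum_times_module scale n (set vs \<union> T) = sum_times_module scale n (S \<union> T)"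
    by (rule obtain_padded_list[OF S(1,2)]) blast
  let ?M = "\<lambda>v. mat_of_cols n (vs @ [v])"
  have M: "?M v \<in> carrier_mat n n" for v
    using mat_of_cols_carrier(1)[of n "vs @ [v]"] vs(1) S(3) by simp
  have col: "col (?M v) k = vs ! k" if "k < n" "k \<noteq> n - 1" "v \<in> carrier_vec n" for k v
  proof -
    have k: "k < length vs" using that vs(1) by auto
    then have "vs ! k \<in> carrier_vec n" using vs(2) nth_mem by blast
    then show ?thesis using k that by (simp add: col_mat_of_cols nth_append)
  qed
  have img: "mat_image scale (?M v) = sum_times_module scale n (S \<union> {v})"
    if "v \<in> carrier_vec n" for v
    using that vs eq[of "{v}"] by (simp add: mat_image_eq_sum_times_module[of _ n])
  have imgA: "mat_image scale (?M (0\<^sub>v n)) = sum_times_module scale n S"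
    using img[of "0\<^sub>v n"] sum_times_module_insert_zero[OF S(1)] by simp
  show "\<not> (sum_times_module scale n S \<subset> sum_times_module scale n (S \<union> {u}) \<and>
         sum_times_module scale n (S \<union> {u}) \<subset> sum_times_module scale n (S \<union> {t}))"
    using no_changed_column_chainD[OF assms M M M, of "n - 1" "0\<^sub>v n" u t]
      S(3) col tu imgA img[OF tu(1)] img[OF tu(2)] by simp
qed

lemma exchange_property_iff_no_added_column_chain:
  "exchange_property (carrier_vec n) (module_cl scale n) \<longleftrightarrow> no_added_column_chain scale n"
  using exchange_property_if_no_added_column_chain no_added_column_chain_if_no_vector_chain
    exchange_property_iff_no_vector_chain by blast

lemma exchange_property_iff_no_changed_column_chain:
  "exchange_property (carrier_vec n) (module_cl scale n) \<longleftrightarrow> no_changed_column_chain scale n"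
  using exchange_property_if_no_changed_column_chain no_changed_column_chain_if_no_vector_chain
    exchange_property_iff_no_vector_chain by blast

end

subsection \<open>Division rings of additive relations\<close>

definition rel_plus :: "('l::ab_group_add \<times> 'l) set \<Rightarrow> ('l \<times> 'l) set \<Rightarrow> ('l \<times> 'l) set" where
  "rel_plus \<Gamma> \<Delta> = {(l, m + m') | l m m'. (l, m) \<in> \<Gamma> \<and> (l, m') \<in> \<Delta>}"

definition rel_uminus :: "('l::ab_group_add \<times> 'l) set \<Rightarrow> ('l \<times> 'l) set" where
  "rel_uminus \<Gamma> = {(l, - m) | l m. (l, m) \<in> \<Gamma>}"

definition rel_zero :: "('l::ab_group_add \<times> 'l) set" where
  "rel_zero = {(l, 0) | l. True}"

text \<open>The identification of relations by a common value at every l. In particular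
  \<open>rel_sim \<Gamma> \<Gamma>\<close> says that \<Gamma> is total. It is symmetric, but
  transitive only under further assumptions.\<close>

definition rel_sim :: "('l \<times> 'l) set \<Rightarrow> ('l \<times> 'l) set \<Rightarrow> bool" where
  "rel_sim \<Gamma> \<Delta> \<longleftrightarrow> (\<forall>l. \<exists>m. (l, m) \<in> \<Gamma> \<and> (l, m) \<in> \<Delta>)"

lemma rel_sim_sym: "rel_sim \<Gamma> \<Delta> \<Longrightarrow> rel_sim \<Delta> \<Gamma>"
  by (auto simp: rel_sim_def)

lemma rel_sim_if_subset: "rel_sim \<Gamma> \<Gamma> \<Longrightarrow> \<Gamma> \<subseteq> \<Delta> \<Longrightarrow> rel_sim \<Gamma> \<Delta>"
  unfolding rel_sim_def by blast

lemma rel_sim_plus: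
  assumes "rel_sim \<Gamma> \<Gamma>'" "rel_sim \<Delta> \<Delta>'"
  shows "rel_sim (rel_plus \<Gamma> \<Delta>) (rel_plus \<Gamma>' \<Delta>')"
  unfolding rel_sim_def
proof
  fix l
  from assms obtain m n where "(l, m) \<in> \<Gamma>" "(l, m) \<in> \<Gamma>'" "(l, n) \<in> \<Delta>" "(l, n) \<in> \<Delta>'"
    unfolding rel_sim_def by blast
  then show "\<exists>m. (l, m) \<in> rel_plus \<Gamma> \<Delta> \<and> (l, m) \<in> rel_plus \<Gamma>' \<Delta>'"
    unfolding rel_plus_def by blast
qed

lemma rel_sim_relcomp:
  assumes "rel_sim \<Gamma> \<Gamma>'" "rel_sim \<Delta> \<Delta>'"
  shows "rel_sim (\<Gamma> O \<Delta>) (\<Gamma>' O \<Delta>')"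
  unfolding rel_sim_def
proof
  fix l
  from assms(1) obtain m where "(l, m) \<in> \<Gamma>" "(l, m) \<in> \<Gamma>'" unfolding rel_sim_def by blast
  moreover from assms(2) obtain k where "(m, k) \<in> \<Delta>" "(m, k) \<in> \<Delta>'"
    unfolding rel_sim_def by blast
  ultimately show "\<exists>k. (l, k) \<in> \<Gamma> O \<Delta> \<and> (l, k) \<in> \<Gamma>' O \<Delta>'" by blast
qed

text \<open>The relations live on L, while the division ring must have elements of a type built from
  R. So relations are represented by codes in \<open>C\<close>, decoded by \<open>rel\<close>, and
  ring elements become sets of codes.\<close>

locale division_relations =
  fixes C :: "'c set" and rel :: "'c \<Rightarrow> ('l::ab_group_add \<times> 'l) set"
  assumes total: "\<Gamma> \<in> rel ` C \<Longrightarrow> rel_sim \<Gamma> \<Gamma>"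
    and additive: "\<Gamma> \<in> rel ` C \<Longrightarrow> (l, m) \<in> \<Gamma> \<Longrightarrow> (l', m') \<in> \<Gamma> \<Longrightarrow> (l + l', m + m') \<in> \<Gamma>"
    and plus: "\<Gamma> \<in> rel ` C \<Longrightarrow> \<Delta> \<in> rel ` C \<Longrightarrow> rel_plus \<Gamma> \<Delta> \<in> rel ` C"
    and uminus: "\<Gamma> \<in> rel ` C \<Longrightarrow> rel_uminus \<Gamma> \<in> rel ` C"
    and comp: "\<Gamma> \<in> rel ` C \<Longrightarrow> \<Delta> \<in> rel ` C \<Longrightarrow> \<Gamma> O \<Delta> \<in> rel ` C"
    and Id: "Id \<in> rel ` C"
    and zero: "rel_zero \<in> rel ` C"
    and converse: "\<Gamma> \<in> rel ` C \<Longrightarrow> \<not> rel_sim \<Gamma> rel_zero \<Longrightarrow> \<Gamma>\<inverse> \<in> rel ` C"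
    and trans: "\<Gamma> \<in> rel ` C \<Longrightarrow> \<Delta> \<in> rel ` C \<Longrightarrow> \<Theta> \<in> rel ` C \<Longrightarrow>
      rel_sim \<Gamma> \<Delta> \<Longrightarrow> rel_sim \<Delta> \<Theta> \<Longrightarrow> rel_sim \<Gamma> \<Theta>"
    and nonzero: "\<exists>l::'l. l \<noteq> 0"
begin

definition cls :: "('l \<times> 'l) set \<Rightarrow> 'c set" where
  "cls \<Gamma> = {c \<in> C. rel_sim (rel c) \<Gamma>}"

definition rep :: "'c set \<Rightarrow> ('l \<times> 'l) set" where
  "rep X = rel (SOME c. c \<in> X)"

text \<open>\<open>O\<close> composes from left to right, whereas a product acts by its right factor
  first; hence the reversed order.\<close>

definition quotient_ring :: "'c set ring" where
  "quotient_ring = \<lparr>carrier = cls ` rel ` C, mult = (\<lambda>X Y. cls (rep Y O rep X)), one = cls Id,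
     zero = cls rel_zero, add = (\<lambda>X Y. cls (rel_plus (rep X) (rep Y)))\<rparr>"

text \<open>Transitivity enters here: it turns agreement of two relations into equality of the sets
  of codes agreeing with them.\<close>

lemma cls_eq_iff:
  assumes "\<Gamma> \<in> rel ` C" "\<Delta> \<in> rel ` C"
  shows "cls \<Gamma> = cls \<Delta> \<longleftrightarrow> rel_sim \<Gamma> \<Delta>"
proof
  assume eq: "cls \<Gamma> = cls \<Delta>"
  from assms(1) obtain c where "c \<in> C" "\<Gamma> = rel c" by blast
  then have "c \<in> cls \<Gamma>" using total[OF assms(1)] by (simp add: cls_def)
  then show "rel_sim \<Gamma> \<Delta>" unfolding eq using \<open>\<Gamma> = rel c\<close> by (simp add: cls_def)
next
  assume "rel_sim \<Gamma> \<Delta>"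
  then have "rel_sim (rel c) \<Gamma> \<longleftrightarrow> rel_sim (rel c) \<Delta>" if "c \<in> C" for c
    using that assms trans rel_sim_sym by blast
  then show "cls \<Gamma> = cls \<Delta>" by (auto simp: cls_def)
qed

lemma rep_cls:
  assumes "\<Gamma> \<in> rel ` C"
  shows "rep (cls \<Gamma>) \<in> rel ` C" "rel_sim (rep (cls \<Gamma>)) \<Gamma>"
proof -
  from assms obtain c where "c \<in> C" "\<Gamma> = rel c" by blast
  then have "c \<in> cls \<Gamma>" using total[OF assms(1)] by (simp add: cls_def)
  then have "(SOME c. c \<in> cls \<Gamma>) \<in> cls \<Gamma>" by (rule someI)
  then show "rep (cls \<Gamma>) \<in> rel ` C" "rel_sim (rep (cls \<Gamma>)) \<Gamma>" by (auto simp: cls_def rep_def)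
qed

lemma add_cls:
  assumes "\<Gamma> \<in> rel ` C" "\<Delta> \<in> rel ` C"
  shows "cls \<Gamma> \<oplus>\<^bsub>quotient_ring\<^esub> cls \<Delta> = cls (rel_plus \<Gamma> \<Delta>)"
proof -
  have "cls (rel_plus (rep (cls \<Gamma>)) (rep (cls \<Delta>))) = cls (rel_plus \<Gamma> \<Delta>)"
    using rel_sim_plus[OF rep_cls(2)[OF assms(1)] rep_cls(2)[OF assms(2)]]
    by (rule iffD2[OF cls_eq_iff, rotated 2]) (intro plus rep_cls(1) assms)+
  then show ?thesis by (simp add: quotient_ring_def)
qed

lemma mult_cls:
  assumes "\<Gamma> \<in> rel ` C" "\<Delta> \<in> rel ` C"
  shows "cls \<Gamma> \<otimes>\<^bsub>quotient_ring\<^esub> cls \<Delta> = cls (\<Delta> O \<Gamma>)"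
proof -
  have "cls (rep (cls \<Delta>) O rep (cls \<Gamma>)) = cls (\<Delta> O \<Gamma>)"
    using rel_sim_relcomp[OF rep_cls(2)[OF assms(2)] rep_cls(2)[OF assms(1)]]
    by (rule iffD2[OF cls_eq_iff, rotated 2]) (intro comp rep_cls(1) assms)+
  then show ?thesis by (simp add: quotient_ring_def)
qed

lemma carrier_quotient_ring: "carrier quotient_ring = cls ` rel ` C"
  by (simp add: quotient_ring_def)

lemma zero_quotient_ring: "\<zero>\<^bsub>quotient_ring\<^esub> = cls rel_zero"
  by (simp add: quotient_ring_def)

lemma one_quotient_ring: "\<one>\<^bsub>quotient_ring\<^esub> = cls Id"
  by (simp add: quotient_ring_def)

lemmas quotient_ring_simps = add_cls mult_cls zero_quotient_ring one_quotient_ring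

lemma carrierE:
  assumes "X \<in> carrier quotient_ring"
  obtains \<Gamma> where "\<Gamma> \<in> rel ` C" "X = cls \<Gamma>"
  using assms unfolding carrier_quotient_ring by blast

lemma cls_in_carrier: "\<Gamma> \<in> rel ` C \<Longrightarrow> cls \<Gamma> \<in> carrier quotient_ring"
  by (auto simp: carrier_quotient_ring)

lemma cls_eqI:
  assumes "\<Gamma> \<in> rel ` C" "\<Delta> \<in> rel ` C" "\<Gamma> \<subseteq> \<Delta>"
  shows "cls \<Gamma> = cls \<Delta>"
  using rel_sim_if_subset[OF total[OF assms(1)] assms(3)] cls_eq_iff[OF assms(1,2)] by simp

lemma ring_quotient_ring: "ring quotient_ring"
proof (rule ringI)
  show "abelian_group quotient_ring"
  proof (rule abelian_groupI)
    fix X Y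
    assume "X \<in> carrier quotient_ring" "Y \<in> carrier quotient_ring"
    then obtain \<Gamma> \<Delta> where *: "\<Gamma> \<in> rel ` C" "\<Delta> \<in> rel ` C" "X = cls \<Gamma>" "Y = cls \<Delta>"
      by (metis carrierE)
    then show "X \<oplus>\<^bsub>quotient_ring\<^esub> Y \<in> carrier quotient_ring"
      by (simp add: add_cls plus cls_in_carrier)
    have "rel_plus \<Gamma> \<Delta> = rel_plus \<Delta> \<Gamma>"
      unfolding rel_plus_def by (auto simp: add.commute; metis add.commute)
    then show "X \<oplus>\<^bsub>quotient_ring\<^esub> Y = Y \<oplus>\<^bsub>quotient_ring\<^esub> X"
      using * by (simp add: add_cls)
  next
    fix X Y Z
    assume "X \<in> carrier quotient_ring" "Y \<in> carrier quotient_ring" "Z \<in> carrier quotient_ring"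
    then obtain \<Gamma> \<Delta> \<Theta> where *: "\<Gamma> \<in> rel ` C" "\<Delta> \<in> rel ` C" "\<Theta> \<in> rel ` C"
      "X = cls \<Gamma>" "Y = cls \<Delta>" "Z = cls \<Theta>"
      by (metis carrierE)
    have "rel_plus (rel_plus \<Gamma> \<Delta>) \<Theta> \<subseteq> rel_plus \<Gamma> (rel_plus \<Delta> \<Theta>)"
      unfolding rel_plus_def by (force simp: add.assoc)
    then have "cls (rel_plus (rel_plus \<Gamma> \<Delta>) \<Theta>) = cls (rel_plus \<Gamma> (rel_plus \<Delta> \<Theta>))"
      using * by (intro cls_eqI plus)
    then show "X \<oplus>\<^bsub>quotient_ring\<^esub> Y \<oplus>\<^bsub>quotient_ring\<^esub> Z =
        X \<oplus>\<^bsub>quotient_ring\<^esub> (Y \<oplus>\<^bsub>quotient_ring\<^esub> Z)"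
      using * by (simp add: add_cls plus)
  next
    fix X
    assume "X \<in> carrier quotient_ring"
    then obtain \<Gamma> where *: "\<Gamma> \<in> rel ` C" "X = cls \<Gamma>" by (metis carrierE)
    have "rel_plus rel_zero \<Gamma> = \<Gamma>" by (auto simp: rel_plus_def rel_zero_def)
    then show "\<zero>\<^bsub>quotient_ring\<^esub> \<oplus>\<^bsub>quotient_ring\<^esub> X = X"
      using * zero by (simp add: quotient_ring_simps)
    have "(l, - m + m) \<in> rel_plus (rel_uminus \<Gamma>) \<Gamma>" if "(l, m) \<in> \<Gamma>" for l m
      using that unfolding rel_plus_def rel_uminus_def by blast
    \<comment> \<open>In general a proper inclusion: different values of \<Gamma> at one l
      contribute nonzero differences too.\<close>
    then have "rel_zero \<subseteq> rel_plus (rel_uminus \<Gamma>) \<Gamma>"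
      using total[OF *(1)] by (fastforce simp: rel_zero_def rel_sim_def)
    then have "cls rel_zero = cls (rel_plus (rel_uminus \<Gamma>) \<Gamma>)"
      using *(1) by (intro cls_eqI zero plus uminus)
    then have "cls (rel_uminus \<Gamma>) \<oplus>\<^bsub>quotient_ring\<^esub> X = \<zero>\<^bsub>quotient_ring\<^esub>"
      using * uminus by (simp add: quotient_ring_simps)
    then show "\<exists>Y\<in>carrier quotient_ring. Y \<oplus>\<^bsub>quotient_ring\<^esub> X = \<zero>\<^bsub>quotient_ring\<^esub>"
      using cls_in_carrier[OF uminus[OF *(1)]] by blast
  qed (simp add: zero_quotient_ring cls_in_carrier zero)
  show "monoid quotient_ring"
  proof (rule monoidI)
    fix X Y
    assume "X \<in> carrier quotient_ring" "Y \<in> carrier quotient_ring"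
    then show "X \<otimes>\<^bsub>quotient_ring\<^esub> Y \<in> carrier quotient_ring"
      by (metis carrierE mult_cls comp cls_in_carrier)
  next
    fix X Y Z
    assume "X \<in> carrier quotient_ring" "Y \<in> carrier quotient_ring" "Z \<in> carrier quotient_ring"
    then obtain \<Gamma> \<Delta> \<Theta> where *: "\<Gamma> \<in> rel ` C" "\<Delta> \<in> rel ` C" "\<Theta> \<in> rel ` C"
      "X = cls \<Gamma>" "Y = cls \<Delta>" "Z = cls \<Theta>"
      by (metis carrierE)
    then show "X \<otimes>\<^bsub>quotient_ring\<^esub> Y \<otimes>\<^bsub>quotient_ring\<^esub> Z =
        X \<otimes>\<^bsub>quotient_ring\<^esub> (Y \<otimes>\<^bsub>quotient_ring\<^esub> Z)"
      by (simp add: mult_cls comp O_assoc)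
  next
    fix X
    assume "X \<in> carrier quotient_ring"
    then obtain \<Gamma> where *: "\<Gamma> \<in> rel ` C" "X = cls \<Gamma>" by (metis carrierE)
    then show "\<one>\<^bsub>quotient_ring\<^esub> \<otimes>\<^bsub>quotient_ring\<^esub> X = X" "X \<otimes>\<^bsub>quotient_ring\<^esub> \<one>\<^bsub>quotient_ring\<^esub> = X"
      using Id by (simp_all add: quotient_ring_simps)
  qed (simp add: one_quotient_ring cls_in_carrier Id)
next
  fix X Y Z
  assume "X \<in> carrier quotient_ring" "Y \<in> carrier quotient_ring" "Z \<in> carrier quotient_ring"
  then obtain \<Gamma> \<Delta> \<Theta> where *: "\<Gamma> \<in> rel ` C" "\<Delta> \<in> rel ` C" "\<Theta> \<in> rel ` C"
    "X = cls \<Gamma>" "Y = cls \<Delta>" "Z = cls \<Theta>"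
    by (metis carrierE)
  \<comment> \<open>On the right the two summands may pass through different values of
    \<Theta>.\<close>
  have "\<Theta> O rel_plus \<Gamma> \<Delta> \<subseteq> rel_plus (\<Theta> O \<Gamma>) (\<Theta> O \<Delta>)"
    unfolding rel_plus_def by blast
  then have "cls (\<Theta> O rel_plus \<Gamma> \<Delta>) = cls (rel_plus (\<Theta> O \<Gamma>) (\<Theta> O \<Delta>))"
    using * by (intro cls_eqI plus comp)
  then show "(X \<oplus>\<^bsub>quotient_ring\<^esub> Y) \<otimes>\<^bsub>quotient_ring\<^esub> Z =
      X \<otimes>\<^bsub>quotient_ring\<^esub> Z \<oplus>\<^bsub>quotient_ring\<^esub> Y \<otimes>\<^bsub>quotient_ring\<^esub> Z"
    using * by (simp add: add_cls mult_cls plus comp)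
  \<comment> \<open>Here the intermediate values k and k' differ from the outset, and additivity of
    \<Theta> joins the two paths.\<close>
  have "rel_plus (\<Gamma> O \<Theta>) (\<Delta> O \<Theta>) \<subseteq> rel_plus \<Gamma> \<Delta> O \<Theta>"
  proof
    fix p assume "p \<in> rel_plus (\<Gamma> O \<Theta>) (\<Delta> O \<Theta>)"
    then obtain l m m' k k' where p: "p = (l, m + m')"
      and 1: "(l, k) \<in> \<Gamma>" "(k, m) \<in> \<Theta>" "(l, k') \<in> \<Delta>" "(k', m') \<in> \<Theta>"
      unfolding rel_plus_def by blast
    then have "(l, k + k') \<in> rel_plus \<Gamma> \<Delta>" "(k + k', m + m') \<in> \<Theta>"
      using additive[OF *(3)] by (auto simp: rel_plus_def)
    then show "p \<in> rel_plus \<Gamma> \<Delta> O \<Theta>" unfolding p by blast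
  qed
  then have "cls (rel_plus (\<Gamma> O \<Theta>) (\<Delta> O \<Theta>)) = cls (rel_plus \<Gamma> \<Delta> O \<Theta>)"
    using * by (intro cls_eqI plus comp)
  then show "Z \<otimes>\<^bsub>quotient_ring\<^esub> (X \<oplus>\<^bsub>quotient_ring\<^esub> Y) =
      Z \<otimes>\<^bsub>quotient_ring\<^esub> X \<oplus>\<^bsub>quotient_ring\<^esub> Z \<otimes>\<^bsub>quotient_ring\<^esub> Y"
    using * by (simp add: add_cls mult_cls plus comp)
qed

lemma one_neq_zero: "\<one>\<^bsub>quotient_ring\<^esub> \<noteq> \<zero>\<^bsub>quotient_ring\<^esub>"
proof
  assume "\<one>\<^bsub>quotient_ring\<^esub> = \<zero>\<^bsub>quotient_ring\<^esub>"
  then have "rel_sim Id (rel_zero :: ('l \<times> 'l) set)"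
    using cls_eq_iff[OF Id zero] by (simp add: quotient_ring_simps)
  then show False using nonzero by (auto simp: rel_sim_def rel_zero_def)
qed

lemma Units_quotient_ring:
  "Units quotient_ring = carrier quotient_ring - {\<zero>\<^bsub>quotient_ring\<^esub>}"
proof (intro equalityI subsetI)
  interpret ring quotient_ring by (rule ring_quotient_ring)
  fix X assume "X \<in> Units quotient_ring"
  then show "X \<in> carrier quotient_ring - {\<zero>\<^bsub>quotient_ring\<^esub>}"
    using one_neq_zero by (auto simp: Units_def)
next
  fix X assume X: "X \<in> carrier quotient_ring - {\<zero>\<^bsub>quotient_ring\<^esub>}"
  then obtain \<Gamma> where \<Gamma>: "\<Gamma> \<in> rel ` C" "X = cls \<Gamma>" by (metis DiffD1 carrierE)
  have "\<not> rel_sim \<Gamma> rel_zero"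
    using X \<Gamma> cls_eq_iff[OF \<Gamma>(1) zero] by (simp add: quotient_ring_simps)
  then have conv: "\<Gamma>\<inverse> \<in> rel ` C" using converse \<Gamma>(1) by blast
  \<comment> \<open>The first inclusion is totality of \<Gamma>. The second is totality of the
    converse, which holds because the converse has a code again.\<close>
  have Id_subset: "Id \<subseteq> \<Gamma> O \<Gamma>\<inverse>" "Id \<subseteq> \<Gamma>\<inverse> O \<Gamma>"
    using total[OF \<Gamma>(1)] total[OF conv] unfolding rel_sim_def by blast+
  have "cls Id = cls (\<Gamma> O \<Gamma>\<inverse>)" "cls Id = cls (\<Gamma>\<inverse> O \<Gamma>)"
    by (rule cls_eqI[OF Id comp[OF \<Gamma>(1) conv] Id_subset(1)],
        rule cls_eqI[OF Id comp[OF conv \<Gamma>(1)] Id_subset(2)])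
  then have "cls \<Gamma> \<otimes>\<^bsub>quotient_ring\<^esub> cls (\<Gamma>\<inverse>) = \<one>\<^bsub>quotient_ring\<^esub>"
    "cls (\<Gamma>\<inverse>) \<otimes>\<^bsub>quotient_ring\<^esub> cls \<Gamma> = \<one>\<^bsub>quotient_ring\<^esub>"
    using \<Gamma>(1) conv by (simp_all add: quotient_ring_simps)
  then show "X \<in> Units quotient_ring"
    using cls_in_carrier[OF \<Gamma>(1)] cls_in_carrier[OF conv] unfolding \<Gamma>(2) Units_def by blast
qed

lemma is_division_ring_quotient_ring: "is_division_ring quotient_ring"
  unfolding is_division_ring_def
  using ring_quotient_ring one_neq_zero Units_quotient_ring by blast

end

subsection \<open>Exchange for families of columns\<close>

lemma ball_Plus_iff: "(\<forall>k\<in>I <+> J. P k) \<longleftrightarrow> (\<forall>i\<in>I. P (Inl i)) \<and> (\<forall>j\<in>J. P (Inr j))"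
  by (auto simp: Plus_def)

context left_module
begin

text \<open>A row over R applied to a column over L. Index sets of any type are allowed, so that
  block matrices can be indexed by \<open><+>\<close> and bordered ones by \<open>option\<close>
  without renumbering.\<close>

definition lincomb :: "'i set \<Rightarrow> ('i \<Rightarrow> 'r) \<Rightarrow> ('i \<Rightarrow> 'l) \<Rightarrow> 'l" where
  "lincomb I f w = (\<Sum>j\<in>I. scale (f j) (w j))"

lemma lincomb_cong:
  "I = J \<Longrightarrow> (\<And>j. j \<in> J \<Longrightarrow> f j = g j) \<Longrightarrow> (\<And>j. j \<in> J \<Longrightarrow> w j = z j) \<Longrightarrow>
    lincomb I f w = lincomb J g z"
  unfolding lincomb_def by (intro sum.cong) auto

lemma lincomb_add: "lincomb I f (\<lambda>j. w j + z j) = lincomb I f w + lincomb I f z"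
  by (simp add: lincomb_def scale_add_right sum.distrib)

lemma lincomb_uminus_left: "lincomb I (\<lambda>j. - f j) w = - lincomb I f w"
  by (simp add: lincomb_def sum_negf)

lemma lincomb_zero_left [simp]: "lincomb I (\<lambda>j. 0) w = 0"
  by (simp add: lincomb_def)

lemma lincomb_scale_left: "lincomb I (\<lambda>j. r * f j) w = scale r (lincomb I f w)"
  by (simp add: lincomb_def scale_sum_right scale_scale)

lemma lincomb_Plus:
  "finite I \<Longrightarrow> finite J \<Longrightarrow>
    lincomb (I <+> J) f w = lincomb I (\<lambda>i. f (Inl i)) (\<lambda>i. w (Inl i)) + lincomb J (\<lambda>j. f (Inr j)) (\<lambda>j. w (Inr j))"
  by (simp add: lincomb_def sum.Plus)

lemma lincomb_insert_None:
  "finite I \<Longrightarrow> lincomb (insert None (Some ` I)) f w =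
    scale (f None) (w None) + lincomb I (\<lambda>i. f (Some i)) (\<lambda>i. w (Some i))"
  by (simp add: lincomb_def sum.reindex)


text \<open>An enumeration \<open>h\<close> of the rows identifies families with vectors. Closure
  membership then means that a linear system over L is solvable for each l.\<close>

lemma in_module_cl_family_iff:
  assumes h: "bij_betw h {..<n} I" and J: "finite J"
  shows "vec n (\<lambda>k. u (h k)) \<in> module_cl scale n ((\<lambda>j. vec n (\<lambda>k. c j (h k))) ` J) \<longleftrightarrow>
    (\<forall>l. \<exists>w. \<forall>i\<in>I. scale (u i) l = lincomb J (\<lambda>j. c j i) w)"
proof -
  have all: "(\<forall>i\<in>I. P i) \<longleftrightarrow> (\<forall>k<n. P (h k))" for P
    using h by (auto simp: bij_betw_def)
  have "map_vec (\<lambda>a. scale a l) (vec n (\<lambda>k. u (h k))) \<in>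
      sum_times_module scale n ((\<lambda>j. vec n (\<lambda>k. c j (h k))) ` J) \<longleftrightarrow>
    (\<exists>w. \<forall>i\<in>I. scale (u i) l = lincomb J (\<lambda>j. c j i) w)" for l
    unfolding all lincomb_def using J by (subst sum_times_module_image_iff) auto
  then show ?thesis by (auto simp: module_cl_def vec_times_module_def)
qed

lemma exchange_family:
  assumes exch: "exchange_property (carrier_vec (card I)) (module_cl scale (card I))"
    and I: "finite I" and J: "finite J"
    and outside: "\<not> (\<forall>l. \<exists>w. \<forall>i\<in>I. scale (u i) l = lincomb J (\<lambda>j. c j i) w)"
    and inside: "\<And>l. \<exists>w m. \<forall>i\<in>I. scale (u i) l = scale (t i) m + lincomb J (\<lambda>j. c j i) w"
  shows "\<exists>w m. \<forall>i\<in>I. scale (t i) l = scale (u i) m + lincomb J (\<lambda>j. c j i) w"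
proof -
  obtain h where h: "bij_betw h {..<card I} I"
    using ex_bij_betw_nat_finite[OF I] by (auto simp: atLeast0LessThan)
  define V where "V u = vec (card I) (\<lambda>k. u (h k))" for u :: "_ \<Rightarrow> 'r"
  let ?cl = "module_cl scale (card I)"
  define S where "S = (\<lambda>j. V (c j)) ` J"
  have extended: "V y \<in> ?cl (S \<union> {V s}) \<longleftrightarrow>
      (\<forall>l. \<exists>w m. \<forall>i\<in>I. scale (y i) l = scale (s i) m + lincomb J (\<lambda>j. c j i) w)"
    for y s
  proof -
    \<comment> \<open>The adjoined column gets the index \<open>None\<close>, and its coefficient is
      the m of the statement.\<close>
    have "S \<union> {V s} = (\<lambda>k. V (case_option s c k)) ` insert None (Some ` J)"
      by (auto simp: S_def image_image)
    then have "V y \<in> ?cl (S \<union> {V s}) \<longleftrightarrow> (\<forall>l. \<exists>w. \<forall>i\<in>I. scale (y i) l =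
        lincomb (insert None (Some ` J)) (\<lambda>k. case_option s c k i) w)"
      using in_module_cl_family_iff[OF h, of "insert None (Some ` J)" y "case_option s c"] J
      by (simp add: V_def)
    also have "\<dots> \<longleftrightarrow> (\<forall>l. \<exists>w. \<forall>i\<in>I. scale (y i) l =
        scale (s i) (w None) + lincomb J (\<lambda>j. c j i) (\<lambda>j. w (Some j)))"
      by (simp add: lincomb_insert_None[OF J])
    also have "\<dots> \<longleftrightarrow>
      (\<forall>l. \<exists>w m. \<forall>i\<in>I. scale (y i) l = scale (s i) m + lincomb J (\<lambda>j. c j i) w)"
    proof (intro iff_allI iffI)
      fix l assume "\<exists>w. \<forall>i\<in>I. scale (y i) l =
        scale (s i) (w None) + lincomb J (\<lambda>j. c j i) (\<lambda>j. w (Some j))"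
      then show "\<exists>w m. \<forall>i\<in>I. scale (y i) l = scale (s i) m + lincomb J (\<lambda>j. c j i) w"
        by (elim exE) (rule exI, rule exI)
    next
      fix l assume "\<exists>w m. \<forall>i\<in>I. scale (y i) l = scale (s i) m + lincomb J (\<lambda>j. c j i) w"
      then obtain w m where
        "\<forall>i\<in>I. scale (y i) l = scale (s i) m + lincomb J (\<lambda>j. c j i) w" by blast
      then show "\<exists>w. \<forall>i\<in>I. scale (y i) l =
        scale (s i) (w None) + lincomb J (\<lambda>j. c j i) (\<lambda>j. w (Some j))"
        by (intro exI[of _ "case_option m w"]) simp
    qed
    finally show ?thesis .
  qed
  have "V u \<notin> ?cl S"
    using outside in_module_cl_family_iff[OF h J, of u c] by (simp add: V_def S_def)
  moreover have "V u \<in> ?cl (S \<union> {V t})" unfolding extended using inside by blast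
  moreover have "S \<subseteq> carrier_vec (card I)" "V u \<in> carrier_vec (card I)" "V t \<in> carrier_vec (card I)"
    by (auto simp: S_def V_def)
  ultimately have "V t \<in> ?cl (S \<union> {V u})" using exch unfolding exchange_property_def by blast
  then show ?thesis by (simp only: extended)
qed

end

context nonzero_left_module
begin

text \<open>Invariance of dimension: the columns span and the unit vectors are independent, so
  Steinitz compares their numbers.\<close>

lemma card_le_if_spanning_family:
  assumes exch: "exchange_property (carrier_vec (card I)) (module_cl scale (card I))"
    and I: "finite I" and J: "finite J"
    and span: "\<And>v. \<exists>w. \<forall>i\<in>I. v i = lincomb J (\<lambda>j. c j i) w"
  shows "card I \<le> card J"
proof -
  obtain h where h: "bij_betw h {..<card I} I"
    using ex_bij_betw_nat_finite[OF I] by (auto simp: atLeast0LessThan)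
  define n where "n = card I"
  define V where "V u = vec n (\<lambda>k. u (h k))" for u :: "_ \<Rightarrow> 'r"
  obtain js where js: "set js = J" "distinct js" using finite_distinct_list[OF J] by auto
  let ?es = "map (\<lambda>j. V (c j)) js"
  have surj: "x \<in> module_cl scale n (set ?es)" if x: "x \<in> carrier_vec n" for x
  proof -
    define u where "u i = x $ the_inv_into {..<card I} h i" for i
    have "V u = x"
      using x h by (auto simp: V_def u_def n_def bij_betw_def the_inv_into_f_f intro!: eq_vecI)
    moreover have "V u \<in> module_cl scale n ((\<lambda>j. V (c j)) ` J)"
      using span in_module_cl_family_iff[OF h J, of u c] by (auto simp: V_def n_def)
    ultimately show ?thesis using js by simp
  qed
  interpret spanned_closure "carrier_vec n" "module_cl scale n" ?es
  proof
    show "closure_operator (carrier_vec n) (module_cl scale n)"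
      by (rule closure_operator_module_cl)
    show "set ?es \<subseteq> carrier_vec n" by (auto simp: V_def)
    show "carrier_vec n \<subseteq> module_cl scale n (set ?es)" using surj by blast
    fix S t u
    assume "S \<subseteq> carrier_vec n" "t \<in> carrier_vec n" "u \<in> carrier_vec n"
      "u \<notin> module_cl scale n S" "u \<in> module_cl scale n (S \<union> {t})"
    then show "t \<in> module_cl scale n (S \<union> {u})"
      using exch unfolding exchange_property_def n_def by blast
  qed
  \<comment> \<open>Combinations of earlier unit vectors vanish at position i, where e_i l has the
    entry l; a nonzero l separates them.\<close>
  have "unit_vec n i \<notin> module_cl scale n (unit_vec n ` {..<i})" if i: "i < n" for i
  proof
    assume *: "unit_vec n i \<in> module_cl scale n (unit_vec n ` {..<i})"
    obtain l :: 'l where l: "l \<noteq> 0" using nonzero by blast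
    let ?v = "map_vec (\<lambda>a. scale a l) (unit_vec n i)"
    from * have "?v \<in> sum_times_module scale n (unit_vec n ` {..<i})"
      unfolding module_cl_def vec_times_module_def by blast
    then obtain w where "\<forall>k<n. ?v $ k = (\<Sum>j<i. scale (unit_vec n j $ k) (w j))"
      by (subst (asm) sum_times_module_image_iff) auto
    then have "?v $ i = (\<Sum>j<i. scale (unit_vec n j $ i) (w j))" using i by blast
    also have "\<dots> = 0" using i by (intro sum.neutral) auto
    finally show False using i l by (simp add: scale_one)
  qed
  then have "independent_list (module_cl scale n) (map (unit_vec n) [0..<n])"
    by (simp add: independent_list_def take_map atLeast0LessThan)
  then have "length (map (unit_vec n) [0..<n] :: 'r vec list) \<le> length ?es"
    by (intro Steinitz) auto
  then show ?thesis using distinct_card[OF js(2)] js(1) by (simp add: n_def)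
qed

end

subsection \<open>Rational relations\<close>

text \<open>The lower triangular block matrix with rows (a, 0) and (d, b).\<close>

definition block :: "('i \<Rightarrow> 'i \<Rightarrow> 'r::zero) \<Rightarrow> ('j \<Rightarrow> 'i \<Rightarrow> 'r) \<Rightarrow> ('j \<Rightarrow> 'j \<Rightarrow> 'r) \<Rightarrow>
    'i + 'j \<Rightarrow> 'i + 'j \<Rightarrow> 'r" where
  "block a d b = case_sum (\<lambda>i. case_sum (a i) (\<lambda>_. 0)) (\<lambda>j. case_sum (d j) (b j))"

lemma block_simps [simp]:
  "block a d b (Inl i) (Inl i') = a i i'" "block a d b (Inl i) (Inr j') = 0"
  "block a d b (Inr j) (Inl i') = d j i'" "block a d b (Inr j) (Inr j') = b j j'"
  by (simp_all add: block_def)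

context left_module
begin

text \<open>The relation that stands for \<open>f a\<^sup>-\<^sup>1 x\<close>.\<close>

definition rat_rel :: "'i set \<Rightarrow> ('i \<Rightarrow> 'i \<Rightarrow> 'r) \<Rightarrow> ('i \<Rightarrow> 'r) \<Rightarrow> ('i \<Rightarrow> 'r) \<Rightarrow> ('l \<times> 'l) set" where
  "rat_rel I a x f = {(l, lincomb I f w) | l w. \<forall>i\<in>I. lincomb I (a i) w = scale (x i) l}"

text \<open>Only surjectivity on L is required; a kernel of a makes \<open>rat_rel\<close>
  multivalued.\<close>

definition onto_matrix :: "'i set \<Rightarrow> ('i \<Rightarrow> 'i \<Rightarrow> 'r) \<Rightarrow> bool" where
  "onto_matrix I a \<longleftrightarrow> (\<forall>v. \<exists>w. \<forall>i\<in>I. lincomb I (a i) w = v i)"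

text \<open>The triple (a, x, f) is stored in one bordered matrix: a in the first n rows and
  columns, x in the last column and f in the last row.\<close>

definition admissible :: "'r mat set" where
  "admissible = {Q. \<exists>n. Q \<in> carrier_mat (Suc n) (Suc n) \<and> onto_matrix {..<n} (\<lambda>i j. Q $$ (i, j))}"

definition mat_rel :: "'r mat \<Rightarrow> ('l \<times> 'l) set" where
  "mat_rel Q = (let n = dim_row Q - 1 in
     rat_rel {..<n} (\<lambda>i j. Q $$ (i, j)) (\<lambda>i. Q $$ (i, n)) (\<lambda>j. Q $$ (n, j)))"

section \<open>Renumbering of systems and codes by matrices\<close>

lemma lincomb_reindex:
  assumes "bij_betw h J I"
  shows "lincomb J (\<lambda>j. f (h j)) (\<lambda>j. w (h j)) = lincomb I f w"
  unfolding lincomb_def by (rule sum.reindex_bij_betw[OF assms])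

lemma onto_matrixD:
  assumes "onto_matrix I a"
  obtains w where "\<And>i. i \<in> I \<Longrightarrow> lincomb I (a i) w = v i"
  using assms unfolding onto_matrix_def by blast

lemma rat_rel_mem_iff:
  "(l, m) \<in> rat_rel I a x f \<longleftrightarrow>
    (\<exists>w. (\<forall>i\<in>I. lincomb I (a i) w = scale (x i) l) \<and> m = lincomb I f w)"
  by (auto simp: rat_rel_def)

lemma rat_rel_cong:
  assumes "\<And>i j. i \<in> I \<Longrightarrow> j \<in> I \<Longrightarrow> a i j = a' i j" "\<And>i. i \<in> I \<Longrightarrow> x i = x' i"
    "\<And>i. i \<in> I \<Longrightarrow> f i = f' i"
  shows "rat_rel I a x f = rat_rel I a' x' f'"
proof -
  have 1: "lincomb I (a i) w = lincomb I (a' i) w" if "i \<in> I" for i w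
    using assms that by (intro lincomb_cong) auto
  have 2: "lincomb I f w = lincomb I f' w" for w
    using assms by (intro lincomb_cong) auto
  show ?thesis unfolding rat_rel_def 2 using 1 assms(2) by auto
qed

lemma bij_betw_extend:
  assumes h: "bij_betw h J I"
  obtains w' where "\<And>j. j \<in> J \<Longrightarrow> w' (h j) = w j"
  using h by (intro that[of "\<lambda>i. w (the_inv_into J h i)"]) (auto simp: bij_betw_def the_inv_into_f_f)

text \<open>A single \<open>w'\<close> serves all rows f at once, as the equations and the value of
  a relation have to be transported together.\<close>

lemma lincomb_reindex':
  assumes h: "bij_betw h J I"
  obtains w' where "\<And>f. lincomb J (\<lambda>j. f (h j)) w = lincomb I f w'"
proof -
  obtain w' where w': "\<And>j. j \<in> J \<Longrightarrow> w' (h j) = w j" using bij_betw_extend[OF h] by blast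
  show ?thesis
  proof (rule that)
    show "lincomb J (\<lambda>j. f (h j)) w = lincomb I f w'" for f
      unfolding lincomb_reindex[OF h, symmetric] by (rule lincomb_cong) (auto simp: w')
  qed
qed

lemma rat_rel_reindex:
  assumes h: "bij_betw h J I"
  shows "rat_rel J (\<lambda>i j. a (h i) (h j)) (\<lambda>i. x (h i)) (\<lambda>j. f (h j)) = rat_rel I a x f"
    (is "?L = ?R")
proof -
  have all: "(\<forall>i\<in>I. P i) \<longleftrightarrow> (\<forall>k\<in>J. P (h k))" for P
    using h by (auto simp: bij_betw_def)
  have "p \<in> ?L \<longleftrightarrow> p \<in> ?R" for p
  proof (cases p)
    case (Pair l m)
    show ?thesis unfolding Pair rat_rel_mem_iff all
    proof (intro iffI; elim exE conjE)
      fix w assume *: "\<forall>i\<in>J. lincomb J (\<lambda>j. a (h i) (h j)) w = scale (x (h i)) l"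
        "m = lincomb J (\<lambda>j. f (h j)) w"
      obtain w' where "\<And>f. lincomb J (\<lambda>j. f (h j)) w = lincomb I f w'"
        using lincomb_reindex'[OF h] by blast
      then show "\<exists>w. (\<forall>k\<in>J. lincomb I (a (h k)) w = scale (x (h k)) l) \<and> m = lincomb I f w"
        using * by auto
    next
      fix w assume "\<forall>k\<in>J. lincomb I (a (h k)) w = scale (x (h k)) l" "m = lincomb I f w"
      then show "\<exists>w. (\<forall>i\<in>J. lincomb J (\<lambda>j. a (h i) (h j)) w = scale (x (h i)) l) \<and>
          m = lincomb J (\<lambda>j. f (h j)) w"
        by (intro exI[of _ "\<lambda>j. w (h j)"]) (simp add: lincomb_reindex[OF h])
    qed
  qed
  then show ?thesis by blast
qed

lemma onto_matrix_reindex: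
  assumes h: "bij_betw h J I" and a: "onto_matrix I a"
  shows "onto_matrix J (\<lambda>i j. a (h i) (h j))"
  unfolding onto_matrix_def
proof
  fix v :: "_ \<Rightarrow> 'l"
  obtain v' where v': "\<And>j. j \<in> J \<Longrightarrow> v' (h j) = v j" using bij_betw_extend[OF h] by blast
  obtain w where w: "\<And>i. i \<in> I \<Longrightarrow> lincomb I (a i) w = v' i" using onto_matrixD[OF a] by blast
  have "lincomb J (\<lambda>j. a (h i) (h j)) (\<lambda>j. w (h j)) = v i" if "i \<in> J" for i
    using that w[of "h i"] v' h by (auto simp: lincomb_reindex[OF h] bij_betw_def)
  then show "\<exists>w. \<forall>i\<in>J. lincomb J (\<lambda>j. a (h i) (h j)) w = v i" by blast
qed

lemma onto_matrix_cong:
  assumes "\<And>i j. i \<in> I \<Longrightarrow> j \<in> I \<Longrightarrow> a i j = b i j" and "onto_matrix I a"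
  shows "onto_matrix I b"
proof -
  have "lincomb I (b i) w = lincomb I (a i) w" if "i \<in> I" for i w
    using that assms(1) by (intro lincomb_cong) auto
  then show ?thesis using assms(2) unfolding onto_matrix_def by simp
qed

text \<open>Renumbering produces a code from a presentation over any finite index set, so each
  operation may use the index set that suits it.\<close>

lemma rat_rel_in_admissible:
  assumes I: "finite I" and a: "onto_matrix I a"
  shows "rat_rel I a x f \<in> mat_rel ` admissible"
proof -
  define n where "n = card I"
  obtain h where h: "bij_betw h {..<n} I"
    using ex_bij_betw_nat_finite[OF I] by (auto simp: atLeast0LessThan n_def)
  \<comment> \<open>The corner entry receives the default value 0.\<close>
  define Q where "Q = mat (Suc n) (Suc n) (\<lambda>(i, j).
    if i < n then if j < n then a (h i) (h j) else x (h i) else if j < n then f (h j) else 0)"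
  have "mat_rel Q = rat_rel {..<n} (\<lambda>i j. a (h i) (h j)) (\<lambda>i. x (h i)) (\<lambda>j. f (h j))"
    unfolding mat_rel_def Let_def by (rule trans[OF rat_rel_cong]) (auto simp: Q_def)
  then have "rat_rel I a x f = mat_rel Q" by (simp add: rat_rel_reindex[OF h])
  moreover have "Q \<in> admissible"
    unfolding admissible_def
    by (auto simp: Q_def intro!: exI[of _ n] onto_matrix_cong[OF _ onto_matrix_reindex[OF h a]])
  ultimately show ?thesis by blast
qed

lemma admissibleE:
  assumes "\<Gamma> \<in> mat_rel ` admissible"
  obtains n :: nat and a x f where "onto_matrix {..<n} a" "\<Gamma> = rat_rel {..<n} a x f"
proof -
  from assms obtain Q n where "Q \<in> carrier_mat (Suc n) (Suc n)"
    "onto_matrix {..<n} (\<lambda>i j. Q $$ (i, j))" "\<Gamma> = mat_rel Q"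
    unfolding admissible_def by blast
  then show ?thesis by (intro that) (auto simp: mat_rel_def)
qed

section \<open>Totality, additivity and closure under the ring operations\<close>

lemma rat_rel_total: "onto_matrix I a \<Longrightarrow> rel_sim (rat_rel I a x f) (rat_rel I a x f)"
  unfolding rel_sim_def rat_rel_mem_iff
proof
  fix l assume "onto_matrix I a"
  then obtain w where "\<And>i. i \<in> I \<Longrightarrow> lincomb I (a i) w = scale (x i) l"
    using onto_matrixD[where v = "\<lambda>i. scale (x i) l"] by blast
  then show "\<exists>m. (\<exists>w. (\<forall>i\<in>I. lincomb I (a i) w = scale (x i) l) \<and> m = lincomb I f w) \<and>
      (\<exists>w. (\<forall>i\<in>I. lincomb I (a i) w = scale (x i) l) \<and> m = lincomb I f w)" by blast
qed

lemma rat_rel_additive: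
  assumes "(l, m) \<in> rat_rel I a x f" "(l', m') \<in> rat_rel I a x f"
  shows "(l + l', m + m') \<in> rat_rel I a x f"
proof -
  from assms obtain w w' where "\<forall>i\<in>I. lincomb I (a i) w = scale (x i) l" "m = lincomb I f w"
    "\<forall>i\<in>I. lincomb I (a i) w' = scale (x i) l'" "m' = lincomb I f w'"
    by (auto simp: rat_rel_mem_iff)
  then show ?thesis unfolding rat_rel_mem_iff
    by (intro exI[of _ "\<lambda>j. w j + w' j"]) (simp add: lincomb_add scale_add_right)
qed

lemma rel_uminus_rat_rel: "rel_uminus (rat_rel I a x f) = rat_rel I a x (\<lambda>j. - f j)"
  unfolding rel_uminus_def rat_rel_def by (auto simp: lincomb_uminus_left)

text \<open>Forward substitution: solve a w = v in the upper block, then b z = v - d w in the lower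
  one.\<close>

lemma onto_matrix_block:
  fixes a :: "'i \<Rightarrow> 'i \<Rightarrow> 'r" and b :: "'j \<Rightarrow> 'j \<Rightarrow> 'r"
  assumes I: "finite I" "onto_matrix I a" and J: "finite J" "onto_matrix J b"
  shows "onto_matrix (I <+> J) (block a d b)"
  unfolding onto_matrix_def ball_Plus_iff
proof
  fix v :: "'i + 'j \<Rightarrow> 'l"
  obtain w where w: "\<And>i. i \<in> I \<Longrightarrow> lincomb I (a i) w = v (Inl i)"
    using onto_matrixD[OF I(2), where v = "\<lambda>i. v (Inl i)"] by blast
  obtain z where z: "\<And>j. j \<in> J \<Longrightarrow> lincomb J (b j) z = v (Inr j) - lincomb I (d j) w"
    using onto_matrixD[OF J(2), where v = "\<lambda>j. v (Inr j) - lincomb I (d j) w"] by blast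
  show "\<exists>w. (\<forall>i\<in>I. lincomb (I <+> J) (block a d b (Inl i)) w = v (Inl i)) \<and>
      (\<forall>j\<in>J. lincomb (I <+> J) (block a d b (Inr j)) w = v (Inr j))"
    using w z by (intro exI[of _ "case_sum w z"]) (simp add: lincomb_Plus[OF I(1) J(1)])
qed

text \<open>f a^-1 x + g b^-1 y is obtained by solving both systems side by side, with the row (f,
  g) and the column (x, y).\<close>

lemma rel_plus_rat_rel:
  assumes "finite I" "finite J"
  shows "rel_plus (rat_rel I a x f) (rat_rel J b y g) =
    rat_rel (I <+> J) (block a (\<lambda>_ _. 0) b) (case_sum x y) (case_sum f g)" (is "?L = ?R")
proof (intro equalityI subsetI)
  fix p assume "p \<in> ?L"
  then obtain l w z where p: "p = (l, lincomb I f w + lincomb J g z)"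
    and "\<forall>i\<in>I. lincomb I (a i) w = scale (x i) l" "\<forall>j\<in>J. lincomb J (b j) z = scale (y j) l"
    unfolding rel_plus_def rat_rel_def by blast
  then show "p \<in> ?R"
    unfolding p rat_rel_mem_iff ball_Plus_iff
    by (intro exI[of _ "case_sum w z"]) (simp add: lincomb_Plus[OF assms])
next
  fix p assume "p \<in> ?R"
  then obtain l w where p: "p = (l, lincomb (I <+> J) (case_sum f g) w)"
    and *: "\<forall>k\<in>I <+> J. lincomb (I <+> J) (block a (\<lambda>_ _. 0) b k) w = scale (case_sum x y k) l"
    unfolding rat_rel_def by blast
  have "(l, lincomb I f (\<lambda>i. w (Inl i))) \<in> rat_rel I a x f"
    "(l, lincomb J g (\<lambda>j. w (Inr j))) \<in> rat_rel J b y g"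
    unfolding rat_rel_mem_iff
    by (rule exI[of _ "\<lambda>i. w (Inl i)"], use * in \<open>simp add: ball_Plus_iff lincomb_Plus[OF assms]\<close>)
      (rule exI[of _ "\<lambda>j. w (Inr j)"], use * in \<open>simp add: ball_Plus_iff lincomb_Plus[OF assms]\<close>)
  then show "p \<in> ?L"
    unfolding p lincomb_Plus[OF assms] rel_plus_def by auto
qed

text \<open>For g b^-1 y f a^-1 x the equations are a w = x l and b z = y (f w). Moving y f w to the
  left gives the block -y f, the right-hand side (x, 0) and the output row (0, g).\<close>

lemma relcomp_rat_rel:
  assumes "finite I" "finite J"
  shows "rat_rel I a x f O rat_rel J b y g =
    rat_rel (I <+> J) (block a (\<lambda>j i. - y j * f i) b) (case_sum x (\<lambda>_. 0)) (case_sum (\<lambda>_. 0) g)"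
    (is "?L = ?R")
proof (intro equalityI subsetI)
  have d: "lincomb I (\<lambda>i. - y j * f i) w = - scale (y j) (lincomb I f w)" for j w
    by (simp only: lincomb_scale_left scale_minus_left)
  {
    fix p assume "p \<in> ?L"
    then obtain l w z where p: "p = (l, lincomb J g z)"
      and "\<forall>i\<in>I. lincomb I (a i) w = scale (x i) l"
        "\<forall>j\<in>J. lincomb J (b j) z = scale (y j) (lincomb I f w)"
      unfolding rat_rel_def by blast
    then show "p \<in> ?R"
      unfolding p rat_rel_mem_iff ball_Plus_iff
      by (intro exI[of _ "case_sum w z"]) (simp add: lincomb_Plus[OF assms] d
          del: mult_minus_left)
  }
  fix p assume "p \<in> ?R"
  then obtain l w where p: "p = (l, lincomb (I <+> J) (case_sum (\<lambda>_. 0) g) w)"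
    and *: "\<forall>k\<in>I <+> J. lincomb (I <+> J) (block a (\<lambda>j i. - y j * f i) b k) w =
      scale (case_sum x (\<lambda>_. 0) k) l"
    unfolding rat_rel_def by blast
  define m where "m = lincomb I f (\<lambda>i. w (Inl i))"
  have "(l, m) \<in> rat_rel I a x f"
    unfolding rat_rel_mem_iff m_def using *
    by (intro exI[of _ "\<lambda>i. w (Inl i)"]) (simp add: ball_Plus_iff lincomb_Plus[OF assms])
  moreover have "(m, lincomb J g (\<lambda>j. w (Inr j))) \<in> rat_rel J b y g"
    unfolding rat_rel_mem_iff m_def using *
    by (intro exI[of _ "\<lambda>j. w (Inr j)"]) (simp add: ball_Plus_iff lincomb_Plus[OF assms] d
        del: mult_minus_left)
  ultimately show "p \<in> ?L" unfolding p lincomb_Plus[OF assms] by auto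
qed

lemma onto_matrix_singleton: "onto_matrix {()} (\<lambda>_ _. 1)"
  unfolding onto_matrix_def lincomb_def by (auto simp: scale_one intro!: exI[of _ "\<lambda>_. v ()" for v])

text \<open>Multiplication by r is 1 * 1^-1 * r, from the single equation w = r l.\<close>

lemma graph_eq_rat_rel: "{(l, scale r l) | l. True} = rat_rel {()} (\<lambda>_ _. 1) (\<lambda>_. r) (\<lambda>_. 1)"
  unfolding rat_rel_def lincomb_def by (auto simp: scale_one intro!: exI[of _ "\<lambda>_. scale r l" for l])

lemma graph_in_admissible: "{(l, scale r l) | l. True} \<in> mat_rel ` admissible"
  unfolding graph_eq_rat_rel by (rule rat_rel_in_admissible[OF _ onto_matrix_singleton]) simp

end

subsection \<open>The division ring of rational relations\<close>

text \<open>The equations a w = x l and f w = m, with l now unknown, form a square system for (l, w)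
  with matrix rows (0, f) and (-x, a) and right-hand side (m, 0). Exchange provides its
  surjectivity.\<close>

lemma (in left_module) rat_rel_converse:
  fixes a :: "'i \<Rightarrow> 'i \<Rightarrow> 'r"
  assumes exch: "\<And>n. exchange_property (carrier_vec n) (module_cl scale n)"
    and I: "finite I" and a: "onto_matrix I a"
    and nonzero: "\<not> rel_sim (rat_rel I a x f) rel_zero"
  shows "(rat_rel I a x f)\<inverse> \<in> mat_rel ` admissible"
proof -
  define K where "K = insert None (Some ` I)"
  \<comment> \<open>The row \<open>None\<close> carries f, the others a. In these rows u = (0, x), t
    = (1, 0), and \<open>c j\<close> is column j of f above a.\<close>
  define u where "u = case_option 0 x"
  define t where "t = case_option 1 (\<lambda>_::'i. 0 :: 'r)"
  define c where "c j = case_option (f j) (\<lambda>i. a i j)" for j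
  define b where "b k = case_option (- u k) (\<lambda>j. c j k)" for k
  have K: "finite K" using I by (simp add: K_def)
  have c_simps: "(\<lambda>j. c j None) = f" "(\<lambda>j. c j (Some i)) = a i" for i by (simp_all add: c_def)
  have "\<exists>w m. \<forall>k\<in>K. scale (t k) l = scale (u k) m + lincomb I (\<lambda>j. c j k) w" for l
  proof (rule exchange_family[OF exch K I])
    \<comment> \<open>If u were in the closure of the \<open>c j\<close>, then 0 would be a value at
      every l.\<close>
    show "\<not> (\<forall>l. \<exists>w. \<forall>k\<in>K. scale (u k) l = lincomb I (\<lambda>j. c j k) w)"
    proof
      assume *: "\<forall>l. \<exists>w. \<forall>k\<in>K. scale (u k) l = lincomb I (\<lambda>j. c j k) w"
      have "(l, 0) \<in> rat_rel I a x f" for l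
      proof -
        obtain w where w: "\<forall>k\<in>K. scale (u k) l = lincomb I (\<lambda>j. c j k) w" using * by blast
        then have "0 = lincomb I f w" "\<forall>i\<in>I. lincomb I (a i) w = scale (x i) l"
          by (simp_all add: K_def u_def c_simps)
        then show ?thesis unfolding rat_rel_mem_iff by blast
      qed
      then show False using nonzero by (auto simp: rel_sim_def rel_zero_def)
    qed
  next
    fix l
    obtain w where "\<And>i. i \<in> I \<Longrightarrow> lincomb I (a i) w = scale (x i) l"
      using onto_matrixD[OF a, where v = "\<lambda>i. scale (x i) l"] by blast
    then show "\<exists>w m. \<forall>k\<in>K. scale (u k) l = scale (t k) m + lincomb I (\<lambda>j. c j k) w"
      by (intro exI[of _ w] exI[of _ "- lincomb I f w"])
        (simp add: K_def u_def t_def c_simps scale_one)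
  qed
  then have "\<exists>w m. l = lincomb I f w \<and> (\<forall>i\<in>I. 0 = scale (x i) m + lincomb I (a i) w)" for l
    by (simp add: K_def u_def t_def c_simps scale_one)
  then have exchanged: "\<exists>w m. (\<forall>i\<in>I. scale (x i) m + lincomb I (a i) w = 0) \<and> lincomb I f w = l" for l
    by metis
  have b_lincomb: "lincomb K (b k) w = - scale (u k) (w None) + lincomb I (\<lambda>j. c j k) (\<lambda>j. w (Some j))" for k w
    by (simp add: K_def lincomb_insert_None[OF I] b_def)
  have "onto_matrix K b"
    unfolding onto_matrix_def
  proof
    fix v :: "'i option \<Rightarrow> 'l"
    obtain w where w: "\<And>i. i \<in> I \<Longrightarrow> lincomb I (a i) w = v (Some i)"
      using onto_matrixD[OF a, where v = "\<lambda>i. v (Some i)"] by blast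
    \<comment> \<open>w solves the rows of a. Adding z repairs the row \<open>None\<close>, and the
      column -u with coefficient -m cancels the change a z in the other rows.\<close>
    obtain z m where z: "\<forall>i\<in>I. scale (x i) m + lincomb I (a i) z = 0"
      "lincomb I f z = v None - lincomb I f w"
      using exchanged[of "v None - lincomb I f w"] by blast
    have z': "lincomb I (a i) z = - scale (x i) m" if "i \<in> I" for i
      using z(1) that by (simp add: eq_neg_iff_add_eq_0 add.commute)
    show "\<exists>w. \<forall>k\<in>K. lincomb K (b k) w = v k"
    proof (intro exI ballI)
      fix k assume "k \<in> K"
      then show "lincomb K (b k) (case_option (- m) (\<lambda>j. w j + z j)) = v k"
        unfolding b_lincomb using w z(2) z' by (auto simp: K_def u_def c_simps lincomb_add)
    qed
  qed
  moreover have "(rat_rel I a x f)\<inverse> = rat_rel K b t (case_option 1 (\<lambda>_. 0))" (is "?L = ?R")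
  proof -
    have "(m, l) \<in> ?L \<longleftrightarrow> (m, l) \<in> ?R" for m l
    proof
      assume "(m, l) \<in> ?L"
      then obtain w where "\<forall>i\<in>I. lincomb I (a i) w = scale (x i) l" "m = lincomb I f w"
        unfolding converse_iff rat_rel_mem_iff by blast
      then show "(m, l) \<in> ?R"
        unfolding rat_rel_mem_iff b_lincomb
        by (intro exI[of _ "case_option l w"])
          (simp add: K_def u_def t_def c_simps lincomb_insert_None[OF I] scale_one)
    next
      assume "(m, l) \<in> ?R"
      then obtain w where "\<forall>k\<in>K. - scale (u k) (w None) + lincomb I (\<lambda>j. c j k) (\<lambda>j. w (Some j)) = scale (t k) m"
        "l = lincomb K (case_option 1 (\<lambda>_. 0)) w"
        unfolding rat_rel_mem_iff b_lincomb by blast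
      then show "(m, l) \<in> ?L"
        unfolding converse_iff rat_rel_mem_iff
        by (intro exI[of _ "\<lambda>j. w (Some j)"])
          (simp add: K_def u_def t_def c_simps lincomb_insert_None[OF I] scale_one algebra_simps)
    qed
    then show ?thesis by auto
  qed
  ultimately show ?thesis using rat_rel_in_admissible[OF K] by simp
qed

context nonzero_left_module
begin

text \<open>If the conclusion fails, then two exchanges show that the \<open>card I + 1\<close> columns of the
  system generate a space of \<open>card I + 2\<close> rows.\<close>

lemma joint_vanishing:
  fixes F :: "bool \<Rightarrow> 'i \<Rightarrow> 'r"
  assumes exch: "\<And>n. exchange_property (carrier_vec n) (module_cl scale n)"
    and I: "finite I" and a: "onto_matrix I a"
    and vanishing: "\<And>b l. \<exists>w. (\<forall>i\<in>I. lincomb I (a i) w = scale (x i) l) \<and> lincomb I (F b) w = 0"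
  shows "\<exists>w. (\<forall>i\<in>I. lincomb I (a i) w = scale (x i) l) \<and> (\<forall>b. lincomb I (F b) w = 0)"
proof -
  define K where "K = I <+> (UNIV :: bool set)"
  define u where "u = case_sum x (\<lambda>_::bool. 0)"
  define e where "e b = case_sum (\<lambda>_::'i. 0) (\<lambda>b'. if b' = b then 1 else (0 :: 'r))" for b :: bool
  define c where "c j = case_sum (\<lambda>i. a i j) (\<lambda>b. F b j)" for j
  have K: "finite K" using I by (simp add: K_def)
  have c_simps: "(\<lambda>j. c j (Inl i)) = a i" "(\<lambda>j. c j (Inr b)) = F b" for i b by (simp_all add: c_def)
  have "\<forall>l. \<exists>w. \<forall>k\<in>K. scale (u k) l = lincomb I (\<lambda>j. c j k) w"
  proof (rule ccontr)
    assume outside: "\<not> ?thesis"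
    \<comment> \<open>A w that annihilates the other functional leaves an error only in row b, which
      the unit column \<open>e b\<close> absorbs; exchange then reverses the roles of u and
      \<open>e b\<close>.\<close>
    have e: "\<exists>w m. \<forall>k\<in>K. scale (e b k) l = scale (u k) m + lincomb I (\<lambda>j. c j k) w" for b l
    proof (rule exchange_family[OF exch K I outside])
      fix l
      obtain w where "\<forall>i\<in>I. lincomb I (a i) w = scale (x i) l" "lincomb I (F (\<not> b)) w = 0"
        using vanishing by blast
      then show "\<exists>w m. \<forall>k\<in>K. scale (u k) l = scale (e b k) m + lincomb I (\<lambda>j. c j k) w"
        by (intro exI[of _ w] exI[of _ "- lincomb I (F b) w"])
          (cases b; auto simp: K_def ball_Plus_iff u_def e_def c_simps scale_one all_bool_eq)
    qed
    have "card K \<le> card (insert None (Some ` I))"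
    proof (rule card_le_if_spanning_family[OF exch K])
      fix v :: "'i + bool \<Rightarrow> 'l"
      obtain w where w: "\<And>i. i \<in> I \<Longrightarrow> lincomb I (a i) w = v (Inl i)"
        using onto_matrixD[OF a, where v = "\<lambda>i. v (Inl i)"] by blast
      \<comment> \<open>w leaves the remainders \<open>r True\<close> and \<open>r False\<close> in
        the two extra rows, and the exchanged combinations supply them.\<close>
      define r where "r b = v (Inr b) - lincomb I (F b) w" for b
      obtain w1 m1 where 1: "\<forall>k\<in>K. scale (e True k) (r True) = scale (u k) m1 + lincomb I (\<lambda>j. c j k) w1"
        using e by blast
      obtain w2 m2 where 2: "\<forall>k\<in>K. scale (e False k) (r False) = scale (u k) m2 + lincomb I (\<lambda>j. c j k) w2"
        using e by blast
      have "v k = lincomb (insert None (Some ` I)) (\<lambda>j. case_option u c j k)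
          (case_option (m1 + m2) (\<lambda>j. w j + (w1 j + w2 j)))" if k: "k \<in> K" for k
      proof -
        have "lincomb (insert None (Some ` I)) (\<lambda>j. case_option u c j k)
            (case_option (m1 + m2) (\<lambda>j. w j + (w1 j + w2 j))) =
          lincomb I (\<lambda>j. c j k) w + (scale (u k) m1 + lincomb I (\<lambda>j. c j k) w1) +
            (scale (u k) m2 + lincomb I (\<lambda>j. c j k) w2)"
          by (simp add: lincomb_insert_None[OF I] lincomb_add scale_add_right algebra_simps)
        also have "\<dots> = lincomb I (\<lambda>j. c j k) w + scale (e True k) (r True) + scale (e False k) (r False)"
          using 1 2 k by simp
        also have "\<dots> = v k"
          using k w by (cases k) (auto simp: K_def e_def c_simps r_def scale_one split: if_splits)
        finally show ?thesis by simp
      qed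
      then show "\<exists>z. \<forall>k\<in>K. v k = lincomb (insert None (Some ` I)) (\<lambda>j. case_option u c j k) z" by blast
    qed (use I in simp)
    then show False using I by (simp add: K_def card_Plus card_image)
  qed
  then obtain w where "\<forall>k\<in>K. scale (u k) l = lincomb I (\<lambda>j. c j k) w" by blast
  then show ?thesis by (intro exI[of _ w]) (auto simp: K_def ball_Plus_iff u_def c_simps)
qed

text \<open>The two hypotheses may use different solutions of the middle system. With the three
  systems stacked, they say that f1 w1 - f2 w2 and f2 w2 - f3 w3 can each be made zero;
  \<open>joint_vanishing\<close> makes both zero with the same w2.\<close>

lemma rat_rel_sim_trans:
  assumes exch: "\<And>n. exchange_property (carrier_vec n) (module_cl scale n)"
    and fin: "finite I1" "finite I2" "finite I3"
    and onto: "onto_matrix I1 a1" "onto_matrix I2 a2" "onto_matrix I3 a3"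
    and sim: "rel_sim (rat_rel I1 a1 x1 f1) (rat_rel I2 a2 x2 f2)"
      "rel_sim (rat_rel I2 a2 x2 f2) (rat_rel I3 a3 x3 f3)"
  shows "rel_sim (rat_rel I1 a1 x1 f1) (rat_rel I3 a3 x3 f3)"
proof -
  define J where "J = I2 <+> I3"
  define I where "I = I1 <+> J"
  define a where "a = block a1 (\<lambda>_ _. 0) (block a2 (\<lambda>_ _. 0) a3)"
  define x where "x = case_sum x1 (case_sum x2 x3)"
  define F where "F b = (if b then case_sum f1 (case_sum (\<lambda>j. - f2 j) (\<lambda>_. 0))
    else case_sum (\<lambda>_. 0) (case_sum f2 (\<lambda>j. - f3 j)))" for b
  have fin': "finite J" "finite I" using fin by (simp_all add: I_def J_def)
  have a: "onto_matrix I a"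
    unfolding a_def I_def J_def using fin onto by (intro onto_matrix_block) auto
  have lc: "lincomb I f w = lincomb I1 (\<lambda>i. f (Inl i)) (\<lambda>i. w (Inl i)) +
      (lincomb I2 (\<lambda>i. f (Inr (Inl i))) (\<lambda>i. w (Inr (Inl i))) +
       lincomb I3 (\<lambda>i. f (Inr (Inr i))) (\<lambda>i. w (Inr (Inr i))))" for f w
    by (simp add: I_def J_def lincomb_Plus fin)
  have solution: "(\<forall>i\<in>I. lincomb I (a i) w = scale (x i) l) \<longleftrightarrow>
      (\<forall>i\<in>I1. lincomb I1 (a1 i) (\<lambda>i. w (Inl i)) = scale (x1 i) l) \<and>
      (\<forall>i\<in>I2. lincomb I2 (a2 i) (\<lambda>i. w (Inr (Inl i))) = scale (x2 i) l) \<and>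
      (\<forall>i\<in>I3. lincomb I3 (a3 i) (\<lambda>i. w (Inr (Inr i))) = scale (x3 i) l)" for w l
    unfolding lc by (simp add: I_def J_def ball_Plus_iff a_def x_def)
  have F: "lincomb I (F True) w = lincomb I1 f1 (\<lambda>i. w (Inl i)) - lincomb I2 f2 (\<lambda>i. w (Inr (Inl i)))"
    "lincomb I (F False) w = lincomb I2 f2 (\<lambda>i. w (Inr (Inl i))) - lincomb I3 f3 (\<lambda>i. w (Inr (Inr i)))"
    for w
    unfolding lc by (simp_all add: F_def lincomb_uminus_left)
  \<comment> \<open>Each functional involves only two of the three systems; a solution of the
    remaining one is borrowed from the other hypothesis.\<close>
  have vanishing: "\<exists>w. (\<forall>i\<in>I. lincomb I (a i) w = scale (x i) l) \<and> lincomb I (F b) w = 0" for b l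
  proof -
    from sim(1) obtain w1 w2 where 12: "\<forall>i\<in>I1. lincomb I1 (a1 i) w1 = scale (x1 i) l"
      "\<forall>i\<in>I2. lincomb I2 (a2 i) w2 = scale (x2 i) l" "lincomb I1 f1 w1 = lincomb I2 f2 w2"
      unfolding rel_sim_def rat_rel_mem_iff by metis
    from sim(2) obtain w2' w3 where 23: "\<forall>i\<in>I2. lincomb I2 (a2 i) w2' = scale (x2 i) l"
      "\<forall>i\<in>I3. lincomb I3 (a3 i) w3 = scale (x3 i) l" "lincomb I2 f2 w2' = lincomb I3 f3 w3"
      unfolding rel_sim_def rat_rel_mem_iff by metis
    show ?thesis
    proof (cases b)
      case True
      then show ?thesis unfolding solution using 12 23
        by (intro exI[of _ "case_sum w1 (case_sum w2 w3)"]) (simp add: F)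
    next
      case False
      then show ?thesis unfolding solution using 12 23
        by (intro exI[of _ "case_sum w1 (case_sum w2' w3)"]) (simp add: F)
    qed
  qed
  show ?thesis
    unfolding rel_sim_def
  proof
    fix l
    obtain w where w: "\<forall>i\<in>I. lincomb I (a i) w = scale (x i) l" "\<forall>b. lincomb I (F b) w = 0"
      using joint_vanishing[where F = F, OF exch fin'(2) a vanishing] by blast
    then have "lincomb I1 f1 (\<lambda>i. w (Inl i)) = lincomb I3 f3 (\<lambda>i. w (Inr (Inr i)))"
      by (simp add: F all_bool_eq)
    then show "\<exists>m. (l, m) \<in> rat_rel I1 a1 x1 f1 \<and> (l, m) \<in> rat_rel I3 a3 x3 f3"
      using w(1) unfolding solution rat_rel_mem_iff by metis
  qed
qed

lemma division_relations_admissible: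
  assumes exch: "\<And>n. exchange_property (carrier_vec n) (module_cl scale n)"
  shows "division_relations admissible mat_rel"
proof
  fix \<Gamma> assume "\<Gamma> \<in> mat_rel ` admissible"
  then obtain n :: nat and a x f where *: "onto_matrix {..<n} a" "\<Gamma> = rat_rel {..<n} a x f"
    by (rule admissibleE)
  show "rel_sim \<Gamma> \<Gamma>" unfolding *(2) by (rule rat_rel_total[OF *(1)])
  show "rel_uminus \<Gamma> \<in> mat_rel ` admissible"
    unfolding *(2) rel_uminus_rat_rel by (intro rat_rel_in_admissible *(1)) simp
  show "(l + l', m + m') \<in> \<Gamma>" if "(l, m) \<in> \<Gamma>" "(l', m') \<in> \<Gamma>" for l m l' m'
    using that unfolding *(2) by (rule rat_rel_additive)
  show "\<Gamma>\<inverse> \<in> mat_rel ` admissible" if "\<not> rel_sim \<Gamma> rel_zero"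
    using that unfolding *(2) by (intro rat_rel_converse exch *(1)) auto
  fix \<Delta> assume "\<Delta> \<in> mat_rel ` admissible"
  then obtain n' :: nat and b y g where **: "onto_matrix {..<n'} b" "\<Delta> = rat_rel {..<n'} b y g"
    by (rule admissibleE)
  show "rel_plus \<Gamma> \<Delta> \<in> mat_rel ` admissible"
    unfolding *(2) **(2) rel_plus_rat_rel[OF finite_lessThan finite_lessThan]
    by (intro rat_rel_in_admissible onto_matrix_block *(1) **(1)) auto
  show "\<Gamma> O \<Delta> \<in> mat_rel ` admissible"
    unfolding *(2) **(2) relcomp_rat_rel[OF finite_lessThan finite_lessThan]
    by (intro rat_rel_in_admissible onto_matrix_block *(1) **(1)) auto
  fix \<Theta> assume "\<Theta> \<in> mat_rel ` admissible"
  then obtain n'' :: nat and c z h where ***: "onto_matrix {..<n''} c" "\<Theta> = rat_rel {..<n''} c z h"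
    by (rule admissibleE)
  show "rel_sim \<Gamma> \<Theta>" if "rel_sim \<Gamma> \<Delta>" "rel_sim \<Delta> \<Theta>"
    using that unfolding *(2) **(2) ***(2)
    by (rule rat_rel_sim_trans[OF exch finite_lessThan finite_lessThan finite_lessThan *(1) **(1) ***(1)])
next
  have "Id = {(l, scale 1 l) | l. True}" by (auto simp: scale_one)
  then show "Id \<in> mat_rel ` admissible" using graph_in_admissible by metis
  have "rel_zero = {(l, scale 0 l) | l. True}" by (auto simp: rel_zero_def)
  then show "rel_zero \<in> mat_rel ` admissible" using graph_in_admissible by metis
  show "\<exists>l::'l. l \<noteq> 0" by (rule nonzero)
qed

text \<open>R embeds by the graphs of its multiplications on L. Graphs of functions share a value at
  every l only if they are equal, so faithfulness gives injectivity.\<close>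

lemma embeddable_in_division_ring_if_exchange:
  assumes exch: "\<And>n. exchange_property (carrier_vec n) (module_cl scale n)"
    and faithful: "faithful scale"
  shows "embeddable_in_division_ring TYPE('r)"
proof -
  interpret division_relations admissible mat_rel
    by (rule division_relations_admissible[OF exch])
  define graph where "graph r = {(l, scale r l) | l. True}" for r
  have graph: "graph r \<in> mat_rel ` admissible" for r
    unfolding graph_def by (rule graph_in_admissible)
  have "inj (\<lambda>r. cls (graph r))"
  proof (rule injI)
    fix r s assume "cls (graph r) = cls (graph s)"
    then have "rel_sim (graph r) (graph s)" using cls_eq_iff[OF graph graph] by blast
    then have "scale r l = scale s l" for l by (auto simp: rel_sim_def graph_def)
    then have "scale (r - s) l = 0" for l
      using scale_add_left[of "r - s" s l] by simp
    then have "r - s = 0" using faithful unfolding faithful_def by blast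
    then show "r = s" by simp
  qed
  moreover have "graph 1 = Id" by (auto simp: graph_def scale_one)
  then have "cls (graph 1) = \<one>\<^bsub>quotient_ring\<^esub>" by (simp add: one_quotient_ring)
  moreover have "cls (graph (a + b)) = cls (graph a) \<oplus>\<^bsub>quotient_ring\<^esub> cls (graph b)" for a b
  proof -
    have "graph (a + b) = rel_plus (graph a) (graph b)"
      by (auto simp: graph_def rel_plus_def scale_add_left)
    then show ?thesis using add_cls[OF graph graph] by simp
  qed
  moreover have "cls (graph (a * b)) = cls (graph a) \<otimes>\<^bsub>quotient_ring\<^esub> cls (graph b)" for a b
  proof -
    have "graph (a * b) = graph b O graph a"
      by (auto simp: graph_def scale_scale)
    then show ?thesis using mult_cls[OF graph graph] by simp
  qed
  moreover have "range (\<lambda>r. cls (graph r)) \<subseteq> carrier quotient_ring"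
    using cls_in_carrier[OF graph] by blast
  ultimately show ?thesis
    unfolding embeddable_in_division_ring_def using is_division_ring_quotient_ring by blast
qed

end

theorem lemma9:
  fixes scale :: "'r::ring_1 \<Rightarrow> 'l::ab_group_add \<Rightarrow> 'l"
  assumes "left_module scale"
    and "\<exists>l::'l. l \<noteq> 0"
  shows
    "(\<forall>n. closure_operator (carrier_vec n) (module_cl scale n) \<and>
          (\<forall>A. closed_subset (carrier_vec n) (module_cl scale n) A \<longrightarrow> right_submodule n A))
   \<and> (\<forall>n>0. right_submodule n (module_cl scale n {}) \<and>
            module_cl scale n {} \<noteq> carrier_vec n)
   \<and> (\<forall>m n h A. right_module_hom m n h \<longrightarrow> right_submodule n A \<longrightarrow>
          closed_subset (carrier_vec n) (module_cl scale n) A \<longrightarrow>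
          closed_subset (carrier_vec m) (module_cl scale m) {x \<in> carrier_vec m. h x \<in> A})
   \<and> (\<forall>n. (exchange_property (carrier_vec n) (module_cl scale n) \<longleftrightarrow> no_vector_chain scale n) \<and>
          (exchange_property (carrier_vec n) (module_cl scale n) \<longleftrightarrow> no_added_column_chain scale n) \<and>
          (exchange_property (carrier_vec n) (module_cl scale n) \<longleftrightarrow> no_changed_column_chain scale n))
   \<and> (faithful scale \<longrightarrow>
        (\<forall>n. no_vector_chain scale n) \<or> (\<forall>n. no_added_column_chain scale n) \<or>
        (\<forall>n. no_changed_column_chain scale n) \<longrightarrow>
        embeddable_in_division_ring TYPE('r))"
proof -
  interpret nonzero_left_module scale
    using assms by (simp add: nonzero_left_module_def nonzero_left_module_axioms_def)
  show ?thesis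
  proof (intro conjI allI impI)
    fix n A
    assume "closed_subset (carrier_vec n) (module_cl scale n) A"
    then have "A \<subseteq> carrier_vec n" "module_cl scale n A = A" by (simp_all add: closed_subset_def)
    then show "right_submodule n A" using right_submodule_module_cl by metis
  next
    fix n :: nat
    assume "n > 0"
    then show "module_cl scale n {} \<noteq> carrier_vec n"
      using unit_vec_notin_module_cl_empty[of 0 n] by auto
  next
    assume "faithful scale" "(\<forall>n. no_vector_chain scale n) \<or>
      (\<forall>n. no_added_column_chain scale n) \<or> (\<forall>n. no_changed_column_chain scale n)"
    moreover from this(2) have "exchange_property (carrier_vec n) (module_cl scale n)" for n
      using exchange_property_iff_no_vector_chain exchange_property_iff_no_added_column_chain
        exchange_property_iff_no_changed_column_chain by blast
    ultimately show "embeddable_in_division_ring TYPE('r)"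
      by (intro embeddable_in_division_ring_if_exchange)
  qed (rule closure_operator_module_cl right_submodule_module_cl[OF empty_subsetI]
      closed_subset_vimage_right_module_hom exchange_property_iff_no_vector_chain
      exchange_property_iff_no_added_column_chain exchange_property_iff_no_changed_column_chain;
      assumption?)+
qed

end
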